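(* Let $\alpha\in\mathcal R_c$. The following are equivalent: (1) $L^\alpha(\mathbb T)=\mathcal L^\alpha(\mathbb T)$ (that is, $\alpha$ is strongly continuous); (2) $L^\alpha(\mathbb T)$ is weakly sequentially complete.
   Context: $\mathbb T$ is the unit circle and $m$ is normalized arc length (Haar measure) on $\mathbb T$; functions equal a.e. are identified. For $f:\mathbb T\to\mathbb C$ and $w\in\mathbb T$, $f_w(z)=f(\overline wz)$. $\mathcal R_c$ is the set of continuous rotationally symmetric seminorms, i.e. seminorms $\alpha$ on $L^\infty(\mathbb T)$ with $\alpha(1)=1$, $\alpha(|f|)=\alpha(f)$, $\alpha(f_w)=\alpha(f)$ for all $f\in L^\infty(\mathbb T)$, $w\in\mathbb T$, and $\lim_{m(E)\to0^+}\alpha(\chi_E)=0$. For any measurable $f:\mathbb T\to\mathbb C$ put $\alpha(f)=\sup\{\alpha(s):s\text{ a simple function},\ |s|\le|f|\}$. $\mathcal L^\alpha(\mathbb T)$ is the set of measurable $f$ with $\alpha(f)<\infty$, and $L^\alpha(\mathbb T)$ is the $\alpha$-closure of $L^\infty(\mathbb T)$ in $\mathcal L^\alpha(\mathbb T)$. A Banach space is weakly sequentially complete if every weakly Cauchy sequence in it is weakly convergent. *)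

theory Defs
  imports "HOL-Analysis.Analysis"
begin

definition circle_measure :: "complex measure" where
  "circle_measure =
     distr (uniform_measure lborel {0..<2 * pi}) (restrict_space borel (sphere 0 1)) cis"

text \<open>
  Function spaces on the circle are sets of representatives \<^typ>\<open>complex \<Rightarrow> complex\<close> instead of sets
  of a.e.-equivalence classes. Values off the unit circle are irrelevant, since the underlying
  space of \<^const>\<open>circle_measure\<close> is the circle itself.
\<close>

definition Linfty :: "(complex \<Rightarrow> complex) set" where
  "Linfty = {f \<in> borel_measurable circle_measure.
     \<exists>C. AE z in circle_measure. cmod (f z) \<le> C}"

definition rotate_fun :: "complex \<Rightarrow> (complex \<Rightarrow> complex) \<Rightarrow> complex \<Rightarrow> complex" where
  "rotate_fun w f = (\<lambda>z. f (cnj w * z))"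

text \<open>
  The first clause expresses that \<open>\<alpha>\<close> is a function of a.e.-equivalence classes. Only the values
  of \<open>\<alpha>\<close> on \<^const>\<open>Linfty\<close> are constrained, and only these are used below.
\<close>

definition seminorm_on_Linfty :: "((complex \<Rightarrow> complex) \<Rightarrow> real) \<Rightarrow> bool" where
  "seminorm_on_Linfty \<alpha> \<longleftrightarrow>
     (\<forall>f\<in>Linfty. \<forall>g\<in>Linfty. (AE z in circle_measure. f z = g z) \<longrightarrow> \<alpha> f = \<alpha> g) \<and>
     (\<forall>f\<in>Linfty. 0 \<le> \<alpha> f) \<and>
     (\<forall>f\<in>Linfty. \<forall>g\<in>Linfty. \<alpha> (\<lambda>z. f z + g z) \<le> \<alpha> f + \<alpha> g) \<and>
     (\<forall>f\<in>Linfty. \<forall>c. \<alpha> (\<lambda>z. c * f z) = cmod c * \<alpha> f)"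

definition Rc :: "((complex \<Rightarrow> complex) \<Rightarrow> real) set" where
  "Rc = {\<alpha>. seminorm_on_Linfty \<alpha> \<and>
     \<alpha> (\<lambda>z. 1) = 1 \<and>
     (\<forall>f\<in>Linfty. \<alpha> (\<lambda>z. of_real (cmod (f z))) = \<alpha> f) \<and>
     (\<forall>f\<in>Linfty. \<forall>w\<in>sphere 0 1. \<alpha> (rotate_fun w f) = \<alpha> f) \<and>
     ((\<lambda>E. \<alpha> (indicator E)) \<longlongrightarrow> 0)
       (inf (filtercomap (measure circle_measure) (at_right 0)) (principal (sets circle_measure)))}"

definition ext_norm :: "((complex \<Rightarrow> complex) \<Rightarrow> real) \<Rightarrow> (complex \<Rightarrow> complex) \<Rightarrow> ennreal" where
  "ext_norm \<alpha> f =
     (SUP s \<in> {s. simple_function circle_measure s \<and>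
                  (AE z in circle_measure. cmod (s z) \<le> cmod (f z))}. ennreal (\<alpha> s))"

definition calL :: "((complex \<Rightarrow> complex) \<Rightarrow> real) \<Rightarrow> (complex \<Rightarrow> complex) set" where
  "calL \<alpha> = {f \<in> borel_measurable circle_measure. ext_norm \<alpha> f < \<infinity>}"

definition Lalpha :: "((complex \<Rightarrow> complex) \<Rightarrow> real) \<Rightarrow> (complex \<Rightarrow> complex) set" where
  "Lalpha \<alpha> = {f \<in> calL \<alpha>. \<forall>\<epsilon>>0. \<exists>g\<in>Linfty. ext_norm \<alpha> (\<lambda>z. f z - g z) < ennreal \<epsilon>}"

text \<open>
  \<open>V\<close> is a linear space of complex-valued functions and \<open>p\<close> a seminorm on it; the notions below are
  those of the normed space obtained by identifying \<open>f\<close> and \<open>g\<close> whenever \<open>p (f - g) = 0\<close>. Bounded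
  functionals automatically respect this identification.
\<close>

definition bounded_functional_on ::
  "('a \<Rightarrow> complex) set \<Rightarrow> (('a \<Rightarrow> complex) \<Rightarrow> real) \<Rightarrow> (('a \<Rightarrow> complex) \<Rightarrow> complex) \<Rightarrow> bool" where
  "bounded_functional_on V p \<phi> \<longleftrightarrow>
     (\<forall>f\<in>V. \<forall>g\<in>V. \<phi> (\<lambda>x. f x + g x) = \<phi> f + \<phi> g) \<and>
     (\<forall>f\<in>V. \<forall>c. \<phi> (\<lambda>x. c * f x) = c * \<phi> f) \<and>
     (\<exists>C. \<forall>f\<in>V. cmod (\<phi> f) \<le> C * p f)"

definition weakly_Cauchy_on ::
  "('a \<Rightarrow> complex) set \<Rightarrow> (('a \<Rightarrow> complex) \<Rightarrow> real) \<Rightarrow> (nat \<Rightarrow> 'a \<Rightarrow> complex) \<Rightarrow> bool" where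
  "weakly_Cauchy_on V p F \<longleftrightarrow>
     (\<forall>\<phi>. bounded_functional_on V p \<phi> \<longrightarrow> Cauchy (\<lambda>n. \<phi> (F n)))"

definition weakly_convergent_on ::
  "('a \<Rightarrow> complex) set \<Rightarrow> (('a \<Rightarrow> complex) \<Rightarrow> real) \<Rightarrow> (nat \<Rightarrow> 'a \<Rightarrow> complex) \<Rightarrow> bool" where
  "weakly_convergent_on V p F \<longleftrightarrow>
     (\<exists>f\<in>V. \<forall>\<phi>. bounded_functional_on V p \<phi> \<longrightarrow> (\<lambda>n. \<phi> (F n)) \<longlonglongrightarrow> \<phi> f)"

definition weakly_sequentially_complete_on ::
  "('a \<Rightarrow> complex) set \<Rightarrow> (('a \<Rightarrow> complex) \<Rightarrow> real) \<Rightarrow> bool" where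
  "weakly_sequentially_complete_on V p \<longleftrightarrow>
     (\<forall>F. (\<forall>n. F n \<in> V) \<longrightarrow> weakly_Cauchy_on V p F \<longrightarrow> weakly_convergent_on V p F)"

end

theory Submission
  imports Defs "HOL-Probability.Probability_Measure"
begin

text \<open>
  If \<open>L\<^sup>\<alpha>\<close> is weakly sequentially complete and \<open>f \<in> \<L>\<^sup>\<alpha>\<close>, the truncations of \<open>f\<close> form a weakly Cauchy
  sequence, and since \<open>\<alpha>\<close> dominates the \<open>L\<^sup>1\<close>-norm its weak limit can only be \<open>f\<close>.

  Conversely, let \<open>F\<close> be weakly Cauchy in \<open>L\<^sup>\<alpha> = \<L>\<^sup>\<alpha>\<close>. It is norm bounded, by the Hahn-Banach theorem and
  the uniform boundedness principle. Convex combinations \<open>h k\<close> of the tails of \<open>F\<close>, chosen by minimising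
  a strictly convex integral functional, converge a.e. to some \<open>f\<close>, which lies in \<open>\<L>\<^sup>\<alpha>\<close> by Fatou's
  lemma for \<open>\<alpha>\<close>. The sequence \<open>h k - f\<close> tends to \<open>0\<close> a.e. and is weakly Cauchy; as the norm is order
  continuous on \<open>L\<^sup>\<alpha>\<close>, a gliding hump argument shows that it is weakly null. So \<open>f\<close> is the weak limit
  of \<open>F\<close>. No representation of the dual space is needed.
\<close>

section \<open>The Hahn-Banach theorem and uniform boundedness\<close>

text \<open>That \<alpha> dominates the \<open>L^1\<close>-norm is where rotation symmetry is spent.
  Averages of rotates of a bounded \<open>f\<close> have seminorm at most \<open>\<alpha> f\<close>,
  and suitable ones tend in measure to the constant \<open>\<integral> f\<close>; continuity of
  \<alpha> on small sets turns this into convergence in \<alpha>. Norm bounds in \<open>L^1\<close>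
  give no weak compactness, so a limit function cannot be extracted directly. A strictly convex
  integrand of linear growth remains integrable and still controls distances. Fatou's lemma places
  the limit in \<open>calL\<close> only, and this is what the equality of the two spaces repairs.
  The gliding hump itself lives in \<open>Lalpha\<close>: approximation by bounded functions makes
  the norm of a fixed element small on small sets. Two facts stand in for a description of the dual:
  a functional may be composed with multiplication by a bounded function, and integration against a
  bounded function is a bounded functional.\<close>

locale seminormed_functions =
  fixes V :: "('a \<Rightarrow> complex) set" and p :: "('a \<Rightarrow> complex) \<Rightarrow> real"
  assumes V_add: "f \<in> V \<Longrightarrow> g \<in> V \<Longrightarrow> (\<lambda>x. f x + g x) \<in> V"
    and V_cmult: "f \<in> V \<Longrightarrow> (\<lambda>x. c * f x) \<in> V"
    and p_add: "f \<in> V \<Longrightarrow> g \<in> V \<Longrightarrow> p (\<lambda>x. f x + g x) \<le> p f + p g"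
    and p_cmult: "f \<in> V \<Longrightarrow> p (\<lambda>x. c * f x) = cmod c * p f"
begin

text \<open>Positive homogeneity is required only as an inequality for \<open>t > 0\<close>, the
  form that passes to infima; using it for \<open>t\<close> and for \<open>inverse t\<close> gives
  the equality in \<open>sublinear_scale\<close>. Complex scalars return in
  \<open>Hahn_Banach_norming\<close>.\<close>

definition sublinear :: "(('a \<Rightarrow> complex) \<Rightarrow> real) \<Rightarrow> bool" where
  "sublinear q \<longleftrightarrow> (\<forall>f\<in>V. \<forall>g\<in>V. q (\<lambda>x. f x + g x) \<le> q f + q g) \<and>
     (\<forall>f\<in>V. \<forall>t>0. q (\<lambda>x. of_real t * f x) \<le> t * q f)"

lemma sublinear_add: "sublinear q \<Longrightarrow> f \<in> V \<Longrightarrow> g \<in> V \<Longrightarrow> q (\<lambda>x. f x + g x) \<le> q f + q g"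
  by (simp add: sublinear_def)

lemma sublinear_le: "sublinear q \<Longrightarrow> f \<in> V \<Longrightarrow> 0 < t \<Longrightarrow> q (\<lambda>x. of_real t * f x) \<le> t * q f"
  by (simp add: sublinear_def)

lemma sublinear_zero:
  assumes "sublinear q" "f \<in> V"
  shows "q (\<lambda>x. 0) = 0"
proof -
  have z: "(\<lambda>x. 0) \<in> V" using V_cmult[OF assms(2), of 0] by simp
  show ?thesis
    using sublinear_add[OF assms(1) z z] sublinear_le[OF assms(1) z, of "1/2"] by simp
qed

lemma sublinear_scale:
  assumes q: "sublinear q" and f: "f \<in> V" and "0 \<le> t"
  shows "q (\<lambda>x. of_real t * f x) = t * q f"
proof (cases "t = 0")
  case False
  then have t: "0 < t" using \<open>0 \<le> t\<close> by simp
  have "q (\<lambda>x. of_real (inverse t) * (of_real t * f x)) \<le> inverse t * q (\<lambda>x. of_real t * f x)"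
    using t by (intro sublinear_le q V_cmult f) auto
  then have "t * q f \<le> q (\<lambda>x. of_real t * f x)"
    using t by (simp add: field_simps)
  then show ?thesis
    using sublinear_le[OF q f t] t by simp
qed (use sublinear_zero[OF q f] in simp)

lemma sublinear_uminus:
  assumes "sublinear q" "f \<in> V"
  shows "- q (\<lambda>x. - f x) \<le> q f"
  using sublinear_add[OF assms V_cmult[OF assms(2), of "-1"]] sublinear_zero[OF assms] by simp

lemma sublinear_p: "sublinear p"
  by (auto simp: sublinear_def p_add p_cmult)

text \<open>The auxiliary functional in the proof of Hahn-Banach by minimal sublinear functionals:
  it stays sublinear and below \<open>q\<close>, while the parameter \<open>t = 1\<close> shows that
  its value at \<open>- y\<close> is at most \<open>- q y\<close>.\<close>

definition shrink :: "(('a \<Rightarrow> complex) \<Rightarrow> real) \<Rightarrow> ('a \<Rightarrow> complex) \<Rightarrow> ('a \<Rightarrow> complex) \<Rightarrow> real" where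
  "shrink q y f = (if f \<in> V then INF t\<in>{0..}. q (\<lambda>x. f x + of_real t * y x) - t * q y else 0)"

context
  fixes q y assumes q: "sublinear q" and y: "y \<in> V"
begin

lemma shrink_bdd:
  assumes f: "f \<in> V"
  shows "bdd_below ((\<lambda>t. q (\<lambda>x. f x + of_real t * y x) - t * q y) ` {0..})"
proof (rule bdd_belowI2)
  fix t :: real assume "t \<in> {0..}"
  then have "t * q y = q (\<lambda>x. of_real t * y x)"
    using sublinear_scale[OF q y, of t] by simp
  also have "\<dots> = q (\<lambda>x. (f x + of_real t * y x) + - 1 * f x)"
    by simp
  also have "\<dots> \<le> q (\<lambda>x. f x + of_real t * y x) + q (\<lambda>x. - 1 * f x)"
    by (intro sublinear_add q V_add V_cmult f y)
  finally show "- q (\<lambda>x. - 1 * f x) \<le> q (\<lambda>x. f x + of_real t * y x) - t * q y"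
    by simp
qed

lemma shrink_le:
  assumes "f \<in> V" "0 \<le> t"
  shows "shrink q y f \<le> q (\<lambda>x. f x + of_real t * y x) - t * q y"
  using cINF_lower[OF shrink_bdd[OF assms(1)], of t] assms by (simp add: shrink_def)

lemma le_shrink:
  assumes "f \<in> V" "\<And>t. 0 \<le> t \<Longrightarrow> c \<le> q (\<lambda>x. f x + of_real t * y x) - t * q y"
  shows "c \<le> shrink q y f"
  using assms by (auto simp: shrink_def intro!: cINF_greatest)

text \<open>Parameters add: \<open>s\<close> for \<open>f\<close> and \<open>t\<close> for
  \<open>g\<close> give the admissible parameter \<open>s + t\<close> for the sum, and the two
  infima are taken one after the other. Scaling by \<open>t\<close> turns a parameter
  \<open>s\<close> into \<open>t * s\<close>.\<close>

lemma sublinear_shrink: "sublinear (shrink q y)"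
  unfolding sublinear_def
proof safe
  fix f g assume f: "f \<in> V" and g: "g \<in> V"
  have "shrink q y (\<lambda>x. f x + g x) - (q (\<lambda>x. g x + of_real t * y x) - t * q y) \<le> shrink q y f"
    if t: "0 \<le> t" for t
  proof (rule le_shrink[OF f])
    fix s :: real assume s: "0 \<le> s"
    have "shrink q y (\<lambda>x. f x + g x) \<le> q (\<lambda>x. (f x + g x) + of_real (s + t) * y x) - (s + t) * q y"
      using s t by (intro shrink_le V_add f g) auto
    also have "(\<lambda>x. (f x + g x) + of_real (s + t) * y x)
        = (\<lambda>x. (f x + of_real s * y x) + (g x + of_real t * y x))"
      by (simp add: algebra_simps)
    also have "q \<dots> \<le> q (\<lambda>x. f x + of_real s * y x) + q (\<lambda>x. g x + of_real t * y x)"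
      by (intro sublinear_add q V_add V_cmult f g y)
    finally show "shrink q y (\<lambda>x. f x + g x) - (q (\<lambda>x. g x + of_real t * y x) - t * q y)
       \<le> q (\<lambda>x. f x + of_real s * y x) - s * q y"
      by (simp add: algebra_simps)
  qed
  then have "shrink q y (\<lambda>x. f x + g x) - shrink q y f \<le> shrink q y g"
    by (intro le_shrink[OF g]) (simp add: algebra_simps)
  then show "shrink q y (\<lambda>x. f x + g x) \<le> shrink q y f + shrink q y g" by simp
next
  fix f and t :: real assume f: "f \<in> V" and t: "0 < t"
  have "shrink q y (\<lambda>x. of_real t * f x) / t \<le> shrink q y f"
  proof (rule le_shrink[OF f])
    fix s :: real assume s: "0 \<le> s"
    have "shrink q y (\<lambda>x. of_real t * f x) \<le> q (\<lambda>x. of_real t * f x + of_real (t * s) * y x) - (t * s) * q y"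
      using s t by (intro shrink_le V_cmult f) auto
    also have "(\<lambda>x. of_real t * f x + of_real (t * s) * y x) = (\<lambda>x. of_real t * (f x + of_real s * y x))"
      by (simp add: algebra_simps)
    also have "q \<dots> \<le> t * q (\<lambda>x. f x + of_real s * y x)"
      using t by (intro sublinear_le q V_add V_cmult f y)
    finally show "shrink q y (\<lambda>x. of_real t * f x) / t \<le> q (\<lambda>x. f x + of_real s * y x) - s * q y"
      using t by (simp add: field_simps)
  qed
  then show "shrink q y (\<lambda>x. of_real t * f x) \<le> t * shrink q y f"
    using t by (simp add: field_simps)
qed

lemma shrink_le_self: "f \<in> V \<Longrightarrow> shrink q y f \<le> q f"
  using shrink_le[of f 0] by simp

lemma shrink_uminus: "shrink q y (\<lambda>x. - y x) \<le> - q y"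
  using shrink_le[OF V_cmult[OF y, of "-1"], of 1] sublinear_zero[OF q y] by simp

end

lemma exists_minimal_sublinear:
  assumes p0: "sublinear p0" and z: "z \<in> V"
  obtains q where "sublinear q" "\<And>f. f \<in> V \<Longrightarrow> q f \<le> p0 f"
    "\<And>r f. sublinear r \<Longrightarrow> (\<And>f. f \<in> V \<Longrightarrow> r f \<le> q f) \<Longrightarrow> f \<in> V \<Longrightarrow> r f = q f"
proof -
  \<comment> \<open>Fixing the value 0 off \<open>V\<close> makes a member of \<open>A\<close>
    determined by its values on \<open>V\<close>, so the pointwise order of total functions compares
    members there only.\<close>
  define A where "A = {q. sublinear q \<and> (\<forall>f\<in>V. q f \<le> p0 f) \<and> (\<forall>f. f \<notin> V \<longrightarrow> q f = 0)}"
  \<comment> \<open>Zorn's lemma yields maximal elements, so the order is reversed to obtain a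
    minimal one.\<close>
  define P where "P a b \<longleftrightarrow> b \<le> a" for a b :: "('a \<Rightarrow> complex) \<Rightarrow> real"
  have restrict: "(\<lambda>f. if f \<in> V then r f else 0) \<in> A"
    if "sublinear r" "\<And>f. f \<in> V \<Longrightarrow> r f \<le> p0 f" for r
    using that by (auto simp: A_def sublinear_def V_add V_cmult)
  have "\<exists>m\<in>A. \<forall>a\<in>A. P m a \<longrightarrow> a = m"
  proof (rule predicate_Zorn)
    show "partial_order_on A (relation_of P A)"
      by (rule partial_order_on_relation_ofI) (auto simp: P_def)
  next
    fix C assume "C \<in> Chains (relation_of P A)"
    then have CA: "q \<in> A" if "q \<in> C" for q
      using that by (auto simp: Chains_def relation_of_def)
    have chain: "q \<le> r \<or> r \<le> q" if "q \<in> C" "r \<in> C" for q r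
      using that \<open>C \<in> Chains (relation_of P A)\<close> by (auto simp: Chains_def relation_of_def P_def)
    show "\<exists>u\<in>A. \<forall>a\<in>C. P a u"
    proof (cases "C = {}")
      case True
      then show ?thesis using restrict[OF p0] by auto
    next
      case False
      define u where "u f = (if f \<in> V then INF q\<in>C. q f else 0)" for f
      have bdd: "bdd_below ((\<lambda>q. q f) ` C)" if "f \<in> V" for f
      proof (rule bdd_belowI2)
        fix q assume "q \<in> C"
        then have q: "sublinear q" "\<And>f. f \<in> V \<Longrightarrow> q f \<le> p0 f" using CA by (auto simp: A_def)
        have "- p0 (\<lambda>x. - f x) \<le> - q (\<lambda>x. - f x)"
          using q(2)[OF V_cmult[OF that, of "-1"]] by simp
        also have "\<dots> \<le> q f" by (rule sublinear_uminus[OF q(1) that])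
        finally show "- p0 (\<lambda>x. - f x) \<le> q f" .
      qed
      have u_le: "u f \<le> q f" if "q \<in> C" for q f
        using cINF_lower[OF bdd that] CA[OF that] by (auto simp: u_def A_def)
      have le_u: "c \<le> u f" if "f \<in> V" "\<And>q. q \<in> C \<Longrightarrow> c \<le> q f" for c f
        using that False by (auto simp: u_def intro!: cINF_greatest)
      have "sublinear u"
        unfolding sublinear_def
      proof safe
        fix f g assume f: "f \<in> V" and g: "g \<in> V"
        have "u (\<lambda>x. f x + g x) - r g \<le> u f" if r: "r \<in> C" for r
        proof (rule le_u[OF f])
          fix q assume q: "q \<in> C"
          \<comment> \<open>The two infima, taken at \<open>f\<close> and at \<open>g\<close>, are
            handled by one functional: the smaller of the two chain members.\<close>
          define s where "s = (if q \<le> r then q else r)"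
          have s: "s \<in> C" "s f \<le> q f" "s g \<le> r g"
            using q r chain[OF q r] by (auto simp: s_def le_fun_def)
          have "u (\<lambda>x. f x + g x) \<le> s (\<lambda>x. f x + g x)" by (rule u_le[OF s(1)])
          also have "\<dots> \<le> s f + s g"
            using CA[OF s(1)] f g by (auto simp: A_def intro: sublinear_add)
          finally show "u (\<lambda>x. f x + g x) - r g \<le> q f" using s by simp
        qed
        then have "u (\<lambda>x. f x + g x) - u f \<le> u g"
          by (intro le_u[OF g]) (simp add: algebra_simps)
        then show "u (\<lambda>x. f x + g x) \<le> u f + u g" by simp
      next
        fix f and t :: real assume f: "f \<in> V" and t: "0 < t"
        have "u (\<lambda>x. of_real t * f x) / t \<le> u f"
        proof (rule le_u[OF f])
          fix q assume q: "q \<in> C"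
          have "u (\<lambda>x. of_real t * f x) \<le> q (\<lambda>x. of_real t * f x)" by (rule u_le[OF q])
          also have "\<dots> \<le> t * q f"
            using CA[OF q] f t by (auto simp: A_def intro: sublinear_le)
          finally show "u (\<lambda>x. of_real t * f x) / t \<le> q f" using t by (simp add: field_simps)
        qed
        then show "u (\<lambda>x. of_real t * f x) \<le> t * u f" using t by (simp add: field_simps)
      qed
      moreover have "u f \<le> p0 f" if "f \<in> V" for f
      proof -
        obtain q where "q \<in> C" using False by blast
        then show ?thesis using u_le[of q f] CA[of q] that by (force simp: A_def)
      qed
      ultimately have "u \<in> A" by (auto simp: A_def u_def)
      then show ?thesis using u_le by (auto simp: P_def le_fun_def)
    qed
  qed
  then obtain q where q: "q \<in> A" and min: "\<And>a. a \<in> A \<Longrightarrow> a \<le> q \<Longrightarrow> a = q"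
    by (auto simp: P_def)
  show ?thesis
  proof (rule that)
    show "sublinear q" "\<And>f. f \<in> V \<Longrightarrow> q f \<le> p0 f" using q by (auto simp: A_def)
    fix r f assume r: "sublinear r" "\<And>f. f \<in> V \<Longrightarrow> r f \<le> q f" and f: "f \<in> V"
    have "(\<lambda>f. if f \<in> V then r f else 0) \<in> A"
      using q r by (intro restrict) (auto simp: A_def intro: order_trans)
    moreover have "(\<lambda>f. if f \<in> V then r f else 0) \<le> q"
      using q r by (auto simp: le_fun_def A_def)
    ultimately have "(\<lambda>f. if f \<in> V then r f else 0) = q" by (rule min)
    from fun_cong[OF this, of f] f show "r f = q f" by simp
  qed
qed

text \<open>
  A minimal sublinear functional is odd, since shrinking it along \<open>y\<close> forces \<open>q (- y) \<le> - q y\<close>;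
  hence it is real-linear.
\<close>

lemma Hahn_Banach_real:
  assumes z: "z \<in> V"
  obtains q where "\<And>f g. f \<in> V \<Longrightarrow> g \<in> V \<Longrightarrow> q (\<lambda>x. f x + g x) = q f + q g"
    "\<And>f t. f \<in> V \<Longrightarrow> q (\<lambda>x. of_real t * f x) = t * q f"
    "\<And>f. f \<in> V \<Longrightarrow> q f \<le> p f" "p z \<le> q z"
proof -
  \<comment> \<open>Minimising below \<open>shrink p z\<close> instead of \<open>p\<close> makes the
    functional norm \<open>z\<close>: it forces \<open>q (- z) \<le> - p z\<close>, which oddness
    turns into \<open>p z \<le> q z\<close>.\<close>
  obtain q where q: "sublinear q" and le: "\<And>f. f \<in> V \<Longrightarrow> q f \<le> shrink p z f"
    and min: "\<And>r f. sublinear r \<Longrightarrow> (\<And>f. f \<in> V \<Longrightarrow> r f \<le> q f) \<Longrightarrow> f \<in> V \<Longrightarrow> r f = q f"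
    using exists_minimal_sublinear[OF sublinear_shrink[OF sublinear_p z] z] by blast
  have neg: "(\<lambda>x. - f x) \<in> V" if "f \<in> V" for f
    using V_cmult[OF that, of "-1"] by simp
  have odd: "q (\<lambda>x. - f x) = - q f" if f: "f \<in> V" for f
  proof -
    have "q (\<lambda>x. - f x) = shrink q f (\<lambda>x. - f x)"
      by (rule min[symmetric, OF sublinear_shrink[OF q f] shrink_le_self[OF q f] neg[OF f]])
    then show ?thesis
      using shrink_uminus[OF q f] sublinear_uminus[OF q f] by simp
  qed
  show ?thesis
  proof (rule that)
    fix f g assume f: "f \<in> V" and g: "g \<in> V"
    have "- q (\<lambda>x. f x + g x) = q (\<lambda>x. - f x + - g x)"
      using odd[OF V_add[OF f g]] by simp
    also have "\<dots> \<le> - q f + - q g"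
      using sublinear_add[OF q neg[OF f] neg[OF g]] odd[OF f] odd[OF g] by simp
    finally show "q (\<lambda>x. f x + g x) = q f + q g"
      using sublinear_add[OF q f g] by simp
  next
    fix f and t :: real assume f: "f \<in> V"
    show "q (\<lambda>x. of_real t * f x) = t * q f"
    proof (cases "0 \<le> t")
      case False
      then have "q (\<lambda>x. of_real (- t) * f x) = (- t) * q f"
        by (intro sublinear_scale q f) auto
      then show ?thesis using odd[OF V_cmult[OF f, of "of_real t"]] by simp
    qed (rule sublinear_scale[OF q f])
  next
    fix f assume "f \<in> V"
    then show "q f \<le> p f"
      using le shrink_le_self[OF sublinear_p z] order_trans by blast
  next
    show "p z \<le> q z"
      using odd[OF z] le[OF neg[OF z]] shrink_uminus[OF sublinear_p z] by simp
  qed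
qed

text \<open>A complex linear functional is recovered from its real part \<open>q\<close> as
  \<open>q f - i q (i f)\<close>. Its modulus obeys the same bound as \<open>q\<close>, because a
  unimodular factor rotates \<open>\<phi> f\<close> onto the positive real axis.\<close>

lemma Hahn_Banach_norming:
  assumes z: "z \<in> V"
  obtains \<phi> where "\<And>f g. f \<in> V \<Longrightarrow> g \<in> V \<Longrightarrow> \<phi> (\<lambda>x. f x + g x) = \<phi> f + \<phi> g"
    "\<And>f c. f \<in> V \<Longrightarrow> \<phi> (\<lambda>x. c * f x) = c * \<phi> f"
    "\<And>f. f \<in> V \<Longrightarrow> cmod (\<phi> f) \<le> p f" "p z \<le> cmod (\<phi> z)"
proof -
  obtain q where add: "\<And>f g. f \<in> V \<Longrightarrow> g \<in> V \<Longrightarrow> q (\<lambda>x. f x + g x) = q f + q g"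
    and scale: "\<And>f t. f \<in> V \<Longrightarrow> q (\<lambda>x. of_real t * f x) = t * q f"
    and le: "\<And>f. f \<in> V \<Longrightarrow> q f \<le> p f" and z_le: "p z \<le> q z"
    using Hahn_Banach_real[OF z] by blast
  define \<phi> where "\<phi> f = Complex (q f) (- q (\<lambda>x. \<i> * f x))" for f
  have \<phi>_add: "\<phi> (\<lambda>x. f x + g x) = \<phi> f + \<phi> g" if "f \<in> V" "g \<in> V" for f g
    using add[OF that] add[OF V_cmult[OF that(1), of \<i>] V_cmult[OF that(2), of \<i>]]
    by (simp add: \<phi>_def complex_eq_iff distrib_left)
  have \<phi>_scale: "\<phi> (\<lambda>x. of_real t * f x) = of_real t * \<phi> f" if "f \<in> V" for f t
    using scale[OF that, of t] scale[OF V_cmult[OF that, of \<i>], of t]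
    by (simp add: \<phi>_def complex_eq_iff mult.left_commute)
  have \<phi>_i: "\<phi> (\<lambda>x. \<i> * f x) = \<i> * \<phi> f" if "f \<in> V" for f
    using scale[OF that, of "-1"] by (simp add: \<phi>_def complex_eq_iff flip: mult.assoc)
  have \<phi>_cmult: "\<phi> (\<lambda>x. c * f x) = c * \<phi> f" if f: "f \<in> V" for f c
  proof -
    have c: "c = of_real (Re c) + of_real (Im c) * \<i>"
      by (simp add: complex_eq_iff)
    have "\<phi> (\<lambda>x. c * f x) = \<phi> (\<lambda>x. of_real (Re c) * f x + of_real (Im c) * (\<i> * f x))"
      by (subst c) (simp add: algebra_simps)
    also have "\<dots> = of_real (Re c) * \<phi> f + of_real (Im c) * (\<i> * \<phi> f)"
      using f by (simp add: \<phi>_add \<phi>_scale \<phi>_i V_cmult)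
    also have "\<dots> = c * \<phi> f"
      by (subst (3) c) (simp add: algebra_simps)
    finally show ?thesis .
  qed
  show ?thesis
  proof (rule that[OF \<phi>_add \<phi>_cmult])
    fix f assume f: "f \<in> V"
    define u where "u = cnj (sgn (\<phi> f))"
    have "u * \<phi> f = of_real (cmod (\<phi> f))"
    proof (cases "\<phi> f = 0")
      case False
      have "cnj (\<phi> f) * \<phi> f = (of_real (cmod (\<phi> f)))\<^sup>2"
        using complex_norm_square[of "\<phi> f"] by (simp add: mult.commute)
      then show ?thesis
        using False by (simp add: u_def sgn_eq power2_eq_square)
    qed simp
    then have "cmod (\<phi> f) = Re (\<phi> (\<lambda>x. u * f x))"
      by (simp add: \<phi>_cmult[OF f])
    also have "\<dots> = q (\<lambda>x. u * f x)" by (simp add: \<phi>_def)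
    also have "\<dots> \<le> p (\<lambda>x. u * f x)" by (rule le[OF V_cmult[OF f]])
    also have "\<dots> = cmod u * p f" by (rule p_cmult[OF f])
    also have "\<dots> \<le> p f"
    proof -
      \<comment> \<open>Nonnegativity comes from \<open>0 = p (f + (- f))\<close>, which is at most
        \<open>2 * p f\<close>.\<close>
      have "0 \<le> p f"
        using p_add[OF f V_cmult[OF f, of "-1"]] p_cmult[OF f, of "-1"] p_cmult[OF f, of 0] by simp
      then show ?thesis by (simp add: u_def norm_sgn)
    qed
    finally show "cmod (\<phi> f) \<le> p f" .
  next
    show "p z \<le> cmod (\<phi> z)"
      using z_le complex_Re_le_cmod[of "\<phi> z"] by (simp add: \<phi>_def)
  qed
qed

text \<open>
  Sokal's proof of the uniform boundedness principle, with \<open>\<psi> k\<close> norming a vector of norm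
  at least \<open>4 ^ k\<close>: signs can be chosen so that the functional \<open>\<psi> 0 + (\<Sum>k. \<plusminus> 3 ^ - (k + 1) \<psi> (k + 1))\<close>
  is unbounded along these vectors.
\<close>

lemma weakly_Cauchy_imp_bounded:
  assumes F: "\<And>n. F n \<in> V" and wC: "weakly_Cauchy_on V p F"
  obtains K where "\<And>n. p (F n) \<le> K"
proof (rule ccontr)
  assume "\<not> thesis"
  then have "\<forall>k::nat. \<exists>n. 4 ^ k < p (F n)"
    using that by (meson not_le)
  then obtain m where m: "\<And>k::nat. 4 ^ k < p (F (m k))" by metis
  define y where "y k = F (m k)" for k
  have yV: "y k \<in> V" for k by (simp add: y_def F)
  define N where "N k \<phi> \<longleftrightarrow> (\<forall>f\<in>V. \<forall>g\<in>V. \<phi> (\<lambda>x. f x + g x) = \<phi> f + \<phi> g) \<and>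
    (\<forall>f\<in>V. \<forall>c. \<phi> (\<lambda>x. c * f x) = c * \<phi> f) \<and> (\<forall>f\<in>V. cmod (\<phi> f) \<le> p f) \<and> p (y k) \<le> cmod (\<phi> (y k))"
    for k and \<phi> :: "('a \<Rightarrow> complex) \<Rightarrow> complex"
  have "\<exists>\<phi>. N k \<phi>" for k
    unfolding N_def by (rule Hahn_Banach_norming[OF yV[of k]]) blast
  then obtain \<psi> where N: "\<And>k. N k (\<psi> k)" by metis
  have \<psi>_add: "\<psi> k (\<lambda>x. f x + g x) = \<psi> k f + \<psi> k g" if "f \<in> V" "g \<in> V" for k f g
    using N[of k] that unfolding N_def by blast
  have \<psi>_cmult: "\<psi> k (\<lambda>x. c * f x) = c * \<psi> k f"
    and \<psi>_le: "cmod (\<psi> k f) \<le> p f"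
    if "f \<in> V" for k f c
    using N[of k] that unfolding N_def by blast+
  have \<psi>_y: "p (y k) \<le> cmod (\<psi> k (y k))" for k
    using N[of k] unfolding N_def by blast
  \<comment> \<open>The clause for \<open>k = 0\<close> keeps the starting value inside the
    invariant, since dependent choice returns only the invariant and the step relation.\<close>
  have "\<exists>\<Phi>. \<forall>k. ((1/3) ^ k * p (y k) \<le> cmod (\<Phi> k (y k)) \<and> (k = 0 \<longrightarrow> \<Phi> k = \<psi> 0)) \<and>
      (\<exists>c::complex. cmod c = (1/3) ^ Suc k \<and> \<Phi> (Suc k) = (\<lambda>f. \<Phi> k f + c * \<psi> (Suc k) f))"
  proof (rule dependent_nat_choice
      [where P = "\<lambda>k \<phi>. (1/3) ^ k * p (y k) \<le> cmod (\<phi> (y k)) \<and> (k = 0 \<longrightarrow> \<phi> = \<psi> 0)"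
        and Q = "\<lambda>k \<phi> \<phi>'. \<exists>c::complex. cmod c = (1/3) ^ Suc k \<and> \<phi>' = (\<lambda>f. \<phi> f + c * \<psi> (Suc k) f)"])
      show "\<exists>\<phi>. (1/3) ^ 0 * p (y 0) \<le> cmod (\<phi> (y 0)) \<and> (0 = (0::nat) \<longrightarrow> \<phi> = \<psi> 0)"
        using \<psi>_y[of 0] by auto
    next
      fix \<phi> :: "('a \<Rightarrow> complex) \<Rightarrow> complex" and k :: nat
      define a where "a = \<phi> (y (Suc k))"
      define b where "b = complex_of_real ((1/3) ^ Suc k) * \<psi> (Suc k) (y (Suc k))"
      \<comment> \<open>\<open>a + b\<close> and \<open>a - b\<close> differ by
        \<open>2 * b\<close>, so one of the two signs gives modulus at least
        \<open>cmod b\<close>.\<close>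
      have "2 * cmod b = cmod ((a + b) - (a - b))"
        by (simp add: norm_mult flip: mult_2)
      also have "\<dots> \<le> cmod (a + b) + cmod (a - b)" by (rule norm_triangle_ineq4)
      finally have "cmod b \<le> cmod (a + 1 * b) \<or> cmod b \<le> cmod (a + (- 1) * b)" by auto
      then obtain e :: complex where e: "cmod e = 1" "cmod b \<le> cmod (a + e * b)"
        by (metis norm_minus_cancel norm_one)
      have "(1/3) ^ Suc k * p (y (Suc k)) \<le> (1/3) ^ Suc k * cmod (\<psi> (Suc k) (y (Suc k)))"
        by (intro mult_left_mono \<psi>_y) auto
      also have "\<dots> = cmod b" by (simp add: b_def norm_mult norm_power norm_divide)
      finally have "(1/3) ^ Suc k * p (y (Suc k)) \<le> cmod (a + e * b)" using e by simp
      then show "\<exists>\<phi>'. ((1/3) ^ Suc k * p (y (Suc k)) \<le> cmod (\<phi>' (y (Suc k))) \<and> (Suc k = 0 \<longrightarrow> \<phi>' = \<psi> 0)) \<and>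
        (\<exists>c::complex. cmod c = (1/3) ^ Suc k \<and> \<phi>' = (\<lambda>f. \<phi> f + c * \<psi> (Suc k) f))"
        using e(1)
        by (intro exI[of _ "\<lambda>f. \<phi> f + (e * of_real ((1/3) ^ Suc k)) * \<psi> (Suc k) f"] conjI
              exI[of _ "e * of_real ((1/3) ^ Suc k)"])
           (auto simp: a_def b_def norm_mult norm_power norm_divide mult.assoc)
    qed
  then obtain \<Phi> where \<Phi>_y: "\<And>k. (1/3) ^ k * p (y k) \<le> cmod (\<Phi> k (y k))" and \<Phi>_0: "\<Phi> 0 = \<psi> 0"
    and \<Phi>_ex: "\<And>k. \<exists>c::complex. cmod c = (1/3) ^ Suc k \<and> \<Phi> (Suc k) = (\<lambda>f. \<Phi> k f + c * \<psi> (Suc k) f)"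
    by blast
  from \<Phi>_ex obtain c where c: "\<And>k. cmod (c k) = (1/3) ^ Suc k"
    and \<Phi>_Suc: "\<And>k. \<Phi> (Suc k) = (\<lambda>f. \<Phi> k f + c k * \<psi> (Suc k) f)"
    by metis
  have \<Phi>_eq: "\<Phi> n f = \<psi> 0 f + (\<Sum>k<n. c k * \<psi> (Suc k) f)" for n f
    by (induction n) (simp_all add: \<Phi>_0 \<Phi>_Suc add.assoc)
  define \<phi> where "\<phi> f = \<psi> 0 f + (\<Sum>k. c k * \<psi> (Suc k) f)" for f
  have term_le: "cmod (c k * \<psi> (Suc k) f) \<le> (1/3) ^ Suc k * p f" if "f \<in> V" for f k
    unfolding norm_mult c by (intro mult_left_mono \<psi>_le that) auto
  have geo: "summable (\<lambda>k. (1/3) ^ Suc k * r)" for r :: real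
    by (intro summable_mult2) (simp add: summable_geometric)
  have summ: "summable (\<lambda>k. c k * \<psi> (Suc k) f)" if "f \<in> V" for f
    by (rule summable_comparison_test'[OF geo term_le[OF that]])
  \<comment> \<open>The geometric tail from \<open>n\<close> on sums to
    \<open>(1/3) ^ n / 2\<close>. At \<open>y n\<close> it costs at most half of the guaranteed size
    \<open>(1/3) ^ n * p (y n)\<close> of \<open>\<Phi> n\<close>, and the remaining half still
    grows like \<open>(4/3) ^ n\<close>.\<close>
  have tail: "cmod (\<phi> f - \<Phi> n f) \<le> (1/3) ^ n * p f / 2" if f: "f \<in> V" for f n
  proof -
    have "\<phi> f - \<Phi> n f = (\<Sum>k. c (k + n) * \<psi> (Suc (k + n)) f)"
      unfolding \<phi>_def \<Phi>_eq by (subst suminf_minus_initial_segment[OF summ[OF f]]) simp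
    also have "cmod \<dots> \<le> (\<Sum>k. (1/3) ^ Suc k * ((1/3) ^ n * p f))"
    proof (rule norm_suminf_le[OF _ geo])
      fix k show "cmod (c (k + n) * \<psi> (Suc (k + n)) f) \<le> (1/3) ^ Suc k * ((1/3) ^ n * p f)"
        using term_le[OF f, of "k + n"] by (simp add: power_add mult.assoc)
    qed
    also have "\<dots> = (\<Sum>k. (1/3) ^ k * ((1/3) ^ n * p f / 3))"
      by (simp add: field_simps)
    also have "\<dots> = (1/3) ^ n * p f / 2"
      by (subst suminf_mult2[symmetric]) (simp_all add: suminf_geometric summable_geometric)
    finally show ?thesis .
  qed
  have "bounded_functional_on V p \<phi>"
    unfolding bounded_functional_on_def
  proof safe
    fix f g assume f: "f \<in> V" and g: "g \<in> V"
    show "\<phi> (\<lambda>x. f x + g x) = \<phi> f + \<phi> g"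
      using suminf_add[OF summ[OF f] summ[OF g]]
      by (simp add: \<phi>_def \<psi>_add[OF f g] distrib_left)
  next
    fix f and a :: complex assume f: "f \<in> V"
    show "\<phi> (\<lambda>x. a * f x) = a * \<phi> f"
      using suminf_mult[OF summ[OF f], of a]
      by (simp add: \<phi>_def \<psi>_cmult[OF f] distrib_left mult.left_commute)
  next
    have "cmod (\<phi> f) \<le> 3/2 * p f" if f: "f \<in> V" for f
      using tail[OF f, of 0] norm_triangle_ineq2[of "\<phi> f" "\<psi> 0 f"] \<psi>_le[OF f, of 0] \<Phi>_0
      by simp
    then show "\<exists>C. \<forall>f\<in>V. cmod (\<phi> f) \<le> C * p f" by blast
  qed
  then have "Cauchy (\<lambda>n. \<phi> (F n))"
    using wC by (simp add: weakly_Cauchy_on_def)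
  then obtain R where R: "\<And>n. cmod (\<phi> (F n)) \<le> R"
    using Cauchy_Bseq by (metis BseqE)
  have "(4/3) ^ k / 2 \<le> R" for k :: nat
  proof -
    have "(4/3) ^ k / 2 = (1/3) ^ k * 4 ^ k / (2::real)"
      by (simp add: power_divide)
    also have "\<dots> \<le> (1/3) ^ k * p (y k) / 2"
      using m[of k] by (intro divide_right_mono mult_left_mono) (auto simp: y_def)
    also have "\<dots> \<le> cmod (\<phi> (y k))"
      using \<Phi>_y[of k] tail[OF yV, of k k] norm_triangle_ineq2[of "\<Phi> k (y k)" "\<phi> (y k)"]
      by (simp add: norm_minus_commute)
    also have "\<dots> \<le> R" by (simp add: y_def R)
    finally show ?thesis .
  qed
  moreover obtain k where "2 * R < (4/3 :: real) ^ k"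
    using real_arch_pow[of "4/3" "2 * R"] by auto
  ultimately show False
    by (metis less_divide_eq_numeral1(1) mult.commute not_le)
qed

end

section \<open>Almost everywhere convergent convex combinations\<close>

text \<open>These are dyadic convex combinations of a tail of \<open>F\<close>. Midpoints are all
  that the minimisation compares, and any property stable under averaging passes to the whole hull
  by rule induction.\<close>

inductive_set midhull :: "(nat \<Rightarrow> 'a \<Rightarrow> complex) \<Rightarrow> nat \<Rightarrow> ('a \<Rightarrow> complex) set"
  for F N where
  base: "N \<le> n \<Longrightarrow> F n \<in> midhull F N"
| mid: "f \<in> midhull F N \<Longrightarrow> g \<in> midhull F N \<Longrightarrow> (\<lambda>x. (f x + g x) / 2) \<in> midhull F N"

lemma midhull_antimono:
  assumes "f \<in> midhull F N" "M \<le> N"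
  shows "f \<in> midhull F M"
  using assms(1) by induction (use assms(2) in \<open>auto intro: midhull.intros\<close>)

text \<open>The Japanese bracket: strictly convex like the square, but of linear growth, so that its
  integral is finite for every integrable function on a finite measure space.\<close>

definition jb :: "complex \<Rightarrow> real" where "jb x = sqrt (1 + (cmod x)\<^sup>2)"

lemma jb_ge_1: "1 \<le> jb x"
  by (simp add: jb_def)

lemma jb_square: "(jb x)\<^sup>2 = 1 + (cmod x)\<^sup>2"
  by (simp add: jb_def)

lemma jb_le: "jb x \<le> 1 + cmod x"
  unfolding jb_def by (rule real_le_lsqrt) (auto simp: power2_sum)

lemma jb_measurable [measurable]: "jb \<in> borel_measurable borel"
  unfolding jb_def by measurable

text \<open>A quantitative form of the strict convexity of \<^const>\<open>jb\<close>.\<close>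

lemma jb_convexity_defect:
  "(cmod (x - y))\<^sup>2 \<le> 4 * (jb x * jb y * (jb x + jb y)) * ((jb x + jb y) / 2 - jb ((x + y) / 2))"
proof -
  \<comment> \<open>For the vectors \<open>(1, x)\<close> and \<open>(1, y)\<close> in
    \<open>R^3\<close>, \<open>a\<close> and \<open>b\<close> are the norms, \<open>1 + i\<close> is
    the inner product and \<open>2 * m\<close> is the norm of the sum.\<close>
  define a b m i where "a = jb x" and "b = jb y" and "m = jb ((x + y) / 2)" and "i = x \<bullet> y"
  have pos: "1 \<le> a" "1 \<le> b" "1 \<le> m" by (simp_all add: a_def b_def m_def jb_ge_1)
  have sq: "a\<^sup>2 = 1 + (cmod x)\<^sup>2" "b\<^sup>2 = 1 + (cmod y)\<^sup>2" by (simp_all add: a_def b_def jb_square)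
  have "(cmod (x + y))\<^sup>2 = (cmod x)\<^sup>2 + 2 * i + (cmod y)\<^sup>2"
    by (simp add: i_def power2_norm_eq_inner inner_add_left inner_add_right inner_commute)
  moreover have "m\<^sup>2 = 1 + (cmod (x + y))\<^sup>2 / 4"
    by (simp add: m_def jb_square norm_divide power_divide)
  ultimately have msq: "(2 * m)\<^sup>2 = 4 + (cmod x)\<^sup>2 + 2 * i + (cmod y)\<^sup>2"
    by (simp add: power_mult_distrib)
  have d: "(cmod (x - y))\<^sup>2 = (cmod x)\<^sup>2 - 2 * i + (cmod y)\<^sup>2"
    by (simp add: i_def power2_norm_eq_inner inner_diff_left inner_diff_right inner_commute)
  have "i\<^sup>2 \<le> (cmod x)\<^sup>2 * (cmod y)\<^sup>2"
    using Cauchy_Schwarz_ineq[of x y] by (simp add: i_def power2_norm_eq_inner)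
  \<comment> \<open>The right-hand side is the Gram determinant of these two vectors; it equals
    \<open>|x - y|^2 + |x|^2 |y|^2 - i^2\<close>, and Cauchy-Schwarz for \<open>x\<close> and
    \<open>y\<close> discards the rest.\<close>
  then have gram: "(cmod (x - y))\<^sup>2 \<le> (a * b)\<^sup>2 - (1 + i)\<^sup>2"
    unfolding power_mult_distrib sq d by (simp add: algebra_simps power2_sum)
  then have "\<bar>1 + i\<bar> \<le> \<bar>a * b\<bar>"
    unfolding abs_le_square_iff using zero_le_power2[of "cmod (x - y)"] by linarith
  then have i: "1 + i \<le> a * b" "- (1 + i) \<le> a * b" using pos by (auto simp: abs_le_iff)
  have ST: "(a + b)\<^sup>2 - (2 * m)\<^sup>2 = 2 * (a * b - (1 + i))"
    unfolding msq using sq by (simp add: power2_sum)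
  have "0 \<le> (a + b)\<^sup>2 - (2 * m)\<^sup>2" unfolding ST using i by simp
  then have "(2 * m)\<^sup>2 \<le> (a + b)\<^sup>2" by (simp only: diff_ge_0_iff_ge)
  then have T: "2 * m \<le> a + b" by (rule power2_le_imp_le) (use pos in auto)
  have "(cmod (x - y))\<^sup>2 \<le> (a * b + (1 + i)) * (a * b - (1 + i))"
    using gram by (simp add: power2_eq_square algebra_simps)
  also have "\<dots> \<le> (2 * (a * b)) * (a * b - (1 + i))"
    using i by (intro mult_right_mono) auto
  also have "\<dots> = (a * b) * ((a + b)\<^sup>2 - (2 * m)\<^sup>2)"
    unfolding ST by simp
  also have "\<dots> = (a * b) * ((a + b + 2 * m) * (a + b - 2 * m))"
    by (simp only: power2_eq_square square_diff_square_factored)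
  also have "\<dots> \<le> (a * b) * ((2 * (a + b)) * (a + b - 2 * m))"
    using T pos by (intro mult_left_mono mult_right_mono) auto
  also have "\<dots> = 4 * (a * b * (a + b)) * ((a + b) / 2 - m)"
    by (simp add: field_simps)
  finally show ?thesis by (simp add: a_def b_def m_def)
qed

text \<open>
  Midpoint combinations nearly minimising \<open>\<integral> jb\<close> have small convexity defect, and hence
  consecutive ones are close to each other off small sets.
\<close>

lemma (in finite_measure) midhull_AE_convergent:
  fixes F :: "nat \<Rightarrow> 'a \<Rightarrow> complex"
  assumes F: "\<And>n. integrable M (F n)" and K: "\<And>n. (\<integral>x. cmod (F n x) \<partial>M) \<le> K"
  obtains h f where "\<And>k. h k \<in> midhull F k" "f \<in> borel_measurable M"
    "AE x in M. (\<lambda>k. h k x) \<longlonglongrightarrow> f x"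
proof -
  have mh: "integrable M g \<and> (\<integral>x. cmod (g x) \<partial>M) \<le> K" if "g \<in> midhull F N" for g N
    using that
  proof induction
    case (base n)
    then show ?case using F K by simp
  next
    case (mid f g)
    then have int: "integrable M f" "integrable M g" by auto
    have "(\<integral>x. cmod ((f x + g x) / 2) \<partial>M) \<le> (\<integral>x. cmod (f x) / 2 + cmod (g x) / 2 \<partial>M)"
    proof (rule integral_mono)
      show "cmod ((f x + g x) / 2) \<le> cmod (f x) / 2 + cmod (g x) / 2" for x
        using norm_triangle_ineq[of "f x" "g x"] by (simp add: norm_divide)
    qed (use int in auto)
    also have "\<dots> \<le> K" using mid int by simp
    finally show ?case using int by simp
  qed
  define J where "J g = (\<integral>x. jb (g x) \<partial>M)" for g
  define B where "B = measure M (space M) + K"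
  have jb_int: "integrable M (\<lambda>x. jb (g x))" and J_le: "J g \<le> B" if g: "g \<in> midhull F N" for g N
  proof -
    have int: "integrable M (\<lambda>x. 1 + cmod (g x))" using mh[OF g] by simp
    have [measurable]: "g \<in> borel_measurable M" using mh[OF g] by auto
    show jint: "integrable M (\<lambda>x. jb (g x))"
    proof (rule Bochner_Integration.integrable_bound[OF int])
      show "AE x in M. norm (jb (g x)) \<le> norm (1 + cmod (g x))"
      proof (rule AE_I2)
        fix x show "norm (jb (g x)) \<le> norm (1 + cmod (g x))"
          using jb_le[of "g x"] jb_ge_1[of "g x"] by simp
      qed
    qed measurable
    have "J g \<le> (\<integral>x. 1 + cmod (g x) \<partial>M)"
      unfolding J_def by (rule integral_mono[OF jint int]) (rule jb_le)
    also have "\<dots> \<le> B" using mh[OF g] by (simp add: B_def)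
    finally show "J g \<le> B" .
  qed
  have J0: "0 \<le> J g" for g
    unfolding J_def by (rule integral_nonneg_AE) (auto intro: order_trans[OF zero_le_one jb_ge_1])
  define I where "I N = (INF g\<in>midhull F N. J g)" for N
  have bdd: "bdd_below (J ` midhull F N)" for N by (rule bdd_belowI2) (rule J0)
  have I_le: "I N \<le> J g" if "g \<in> midhull F N" for g N
    unfolding I_def by (rule cINF_lower[OF bdd that])
  have ne: "midhull F N \<noteq> {}" for N using midhull.base[of N N F] by auto
  have I_mono: "I N \<le> I N'" if "N \<le> N'" for N N'
    unfolding I_def by (rule cINF_superset_mono[OF ne bdd]) (use that in \<open>auto intro: midhull_antimono\<close>)
  have I_B: "I N \<le> B" for N
    using I_le[OF midhull.base[OF order_refl]] J_le[OF midhull.base[OF order_refl]] order_trans by blast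
  then have bddI: "bdd_above (range I)" by (intro bdd_aboveI2)
  define L where "L = (SUP N. I N)"
  have I_L: "I N \<le> L" for N unfolding L_def by (rule cSUP_upper[OF UNIV_I bddI])
  \<comment> \<open>The rate 64 is fixed by the end of the proof: integrals of size
    \<open>64 ^ - k\<close> survive the weight \<open>32 ^ k\<close> summably, and the resulting
    pointwise decay \<open>32 ^ - k\<close> of the defect beats the growth \<open>8 ^ k\<close> of
    three bracket factors, leaving \<open>4 ^ - k\<close> for the squared distance.\<close>
  define \<eta> :: "nat \<Rightarrow> real" where "\<eta> k = (1/64) ^ k" for k
  have \<eta>: "0 < \<eta> k" "\<eta> (Suc k) \<le> \<eta> k" for k by (auto simp: \<eta>_def)
  have "\<exists>N\<ge>k. L - \<eta> k \<le> I N" for k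
  proof -
    have "L - \<eta> k < L" using \<eta>(1)[of k] by simp
    then obtain N where "L - \<eta> k < I N"
      unfolding L_def using less_cSUP_iff[OF UNIV_not_empty bddI] by auto
    then show ?thesis using I_mono[of N "max N k"] by (intro exI[of _ "max N k"]) auto
  qed
  then obtain N where N: "\<And>k. k \<le> N k" "\<And>k. L - \<eta> k \<le> I (N k)" by metis
  have "\<exists>g\<in>midhull F (N k). J g \<le> I (N k) + \<eta> k" for k
  proof -
    have "I (N k) < I (N k) + \<eta> k" using \<eta>(1)[of k] by simp
    then show ?thesis
      unfolding I_def using cINF_less_iff[OF ne bdd] by (metis less_imp_le)
  qed
  then obtain h where h: "\<And>k. h k \<in> midhull F (N k)" "\<And>k. J (h k) \<le> I (N k) + \<eta> k" by metis
  have J_h: "J (h k) \<le> L + \<eta> k" for k using h(2)[of k] I_L[of "N k"] by linarith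
  have hm [measurable]: "h k \<in> borel_measurable M" for k using mh[OF h(1)[of k]] by auto
  define mi where "mi k x = (h k x + h (Suc k) x) / 2" for k x
  define D where "D k x = (jb (h k x) + jb (h (Suc k) x)) / 2 - jb (mi k x)" for k x
  \<comment> \<open>\<open>N\<close> is not chosen monotone, hence the \<open>min\<close>; with
    either value the infimum over the hull is still within \<open>\<eta> k\<close> of
    \<open>L\<close>.\<close>
  have mi: "mi k \<in> midhull F (min (N k) (N (Suc k)))" for k
    unfolding mi_def by (rule midhull.mid) (auto intro: midhull_antimono[OF h(1)])
  have D0: "0 \<le> D k x" for k x
  proof (rule ccontr)
    assume "\<not> 0 \<le> D k x"
    moreover have "0 < 4 * (jb (h k x) * jb (h (Suc k) x) * (jb (h k x) + jb (h (Suc k) x)))"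
      using jb_ge_1[of "h k x"] jb_ge_1[of "h (Suc k) x"] by simp
    ultimately have "4 * (jb (h k x) * jb (h (Suc k) x) * (jb (h k x) + jb (h (Suc k) x))) * D k x < 0"
      by (simp add: mult_pos_neg)
    then show False
      using jb_convexity_defect[of "h k x" "h (Suc k) x"] zero_le_power2[of "cmod (h k x - h (Suc k) x)"]
      unfolding D_def mi_def by linarith
  qed
  have D_int: "integrable M (D k)" for k
    unfolding D_def using jb_int[OF h(1)] jb_int[OF mi] by auto
  have D_le: "(\<integral>x. D k x \<partial>M) \<le> 2 * \<eta> k" for k
  proof -
    have "L - \<eta> k \<le> J (mi k)"
      using I_le[OF mi[of k]] N(2)[of k] N(2)[of "Suc k"] \<eta>(2)[of k] by (auto simp: min_def split: if_splits)
    then have "(J (h k) + J (h (Suc k))) / 2 - J (mi k) \<le> 2 * \<eta> k"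
      using J_h[of k] J_h[of "Suc k"] \<eta>(2)[of k] by (simp add: field_simps)
    moreover have "(\<integral>x. D k x \<partial>M) = (J (h k) + J (h (Suc k))) / 2 - J (mi k)"
      unfolding D_def J_def using jb_int[OF h(1)] jb_int[OF mi] by simp
    ultimately show ?thesis by simp
  qed
  \<comment> \<open>One summable family controls both quantities: at almost every \<open>x\<close>
    there is a \<open>C\<close> with \<open>jb (h k x) \<le> C * 2 ^ k\<close> and
    \<open>D k x \<le> C * (1/32) ^ k\<close> for all \<open>k\<close>.\<close>
  define u where "u k x = (1/2) ^ k * jb (h k x) + 32 ^ k * D k x" for k x
  have u0: "0 \<le> u k x" for k x
    using D0[of k x] jb_ge_1[of "h k x"] by (simp add: u_def)
  have u_int: "integrable M (u k)" for k
    unfolding u_def using jb_int[OF h(1)] D_int by auto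
  have um [measurable]: "u k \<in> borel_measurable M" for k using u_int by auto
  have u_le: "(\<integral>x. u k x \<partial>M) \<le> (1/2) ^ k * (B + 2)" for k
  proof -
    have "(\<integral>x. u k x \<partial>M) = (1/2) ^ k * J (h k) + 32 ^ k * (\<integral>x. D k x \<partial>M)"
      unfolding u_def J_def using jb_int[OF h(1)] D_int by simp
    also have "\<dots> \<le> (1/2) ^ k * B + 32 ^ k * (2 * \<eta> k)"
      by (intro add_mono mult_left_mono J_le[OF h(1)] D_le) auto
    also have "32 ^ k * (2 * \<eta> k) = 2 * (1/2) ^ k"
      by (simp add: \<eta>_def flip: power_mult_distrib)
    finally show ?thesis by (simp add: algebra_simps)
  qed
  have "(\<integral>\<^sup>+x. (\<Sum>k. ennreal (u k x)) \<partial>M) = (\<Sum>k. \<integral>\<^sup>+x. ennreal (u k x) \<partial>M)"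
    by (rule nn_integral_suminf) measurable
  also have "\<dots> = (\<Sum>k. ennreal (\<integral>x. u k x \<partial>M))"
    using u0 by (simp add: nn_integral_eq_integral[OF u_int])
  also have "\<dots> \<le> (\<Sum>k. ennreal ((1/2) ^ k * (B + 2)))"
    by (intro suminf_le ennreal_leI u_le) auto
  also have "\<dots> = ennreal (\<Sum>k. (1/2) ^ k * (B + 2))"
  proof (rule suminf_ennreal2)
    have "0 \<le> B" using J0 J_le[OF h(1)] order_trans by blast
    then show "0 \<le> (1/2) ^ k * (B + 2)" for k by simp
  qed (intro summable_mult2 summable_geometric, simp)
  also have "\<dots> < \<infinity>" by simp
  finally have "(\<integral>\<^sup>+x. (\<Sum>k. ennreal (u k x)) \<partial>M) \<noteq> \<infinity>" by simp
  then have "AE x in M. (\<Sum>k. ennreal (u k x)) \<noteq> \<infinity>"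
    by (intro nn_integral_PInf_AE) measurable
  then have conv: "AE x in M. convergent (\<lambda>k. h k x)"
  proof eventually_elim
    case (elim x)
    define C where "C = enn2real (\<Sum>k. ennreal (u k x))"
    have C: "u k x \<le> C" for k
    proof -
      have "ennreal (u k x) \<le> (\<Sum>k. ennreal (u k x))"
        using sum_le_suminf[of "\<lambda>k. ennreal (u k x)" "{k}"] by simp
      also have "\<dots> = ennreal C" using elim by (simp add: C_def less_top)
      finally show ?thesis by (simp add: C_def)
    qed
    have C0: "0 \<le> C" using u0[of 0 x] C[of 0] by linarith
    have jC: "jb (h k x) \<le> C * 2 ^ k" and DC: "D k x \<le> C * (1/32) ^ k" for k
    proof -
      have "0 \<le> 32 ^ k * D k x" "0 \<le> (1/2) ^ k * jb (h k x)"
        using D0[of k x] jb_ge_1[of "h k x"] by auto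
      then have "(1/2) ^ k * jb (h k x) \<le> C" "32 ^ k * D k x \<le> C"
        using C[of k] unfolding u_def by linarith+
      then show "jb (h k x) \<le> C * 2 ^ k" "D k x \<le> C * (1/32) ^ k"
        by (simp_all add: power_divide field_simps)
    qed
    have "cmod (h (Suc k) x - h k x) \<le> (1/2) ^ k * (5 * C\<^sup>2)" for k
    proof (rule power2_le_imp_le)
      have j0: "0 \<le> jb z" for z using jb_ge_1[of z] by linarith
      have jC': "jb (h (Suc k) x) \<le> C * (2 * 2 ^ k)" using jC[of "Suc k"] by simp
      have "(cmod (h (Suc k) x - h k x))\<^sup>2 \<le>
         4 * (jb (h k x) * jb (h (Suc k) x) * (jb (h k x) + jb (h (Suc k) x))) * D k x"
        using jb_convexity_defect[of "h k x" "h (Suc k) x"]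
        by (simp add: D_def mi_def norm_minus_commute)
      also have "\<dots> \<le> 4 * ((C * 2 ^ k) * (C * (2 * 2 ^ k)) * (C * 2 ^ k + C * (2 * 2 ^ k))) * (C * (1/32) ^ k)"
        using C0 j0 D0
        by (intro mult_mono add_mono jC jC' DC order_refl) (auto intro!: mult_nonneg_nonneg add_nonneg_nonneg)
      also have "\<dots> = 24 * C ^ 4 * (2 ^ k * 2 ^ k * 2 ^ k * (1/32) ^ k)"
        by (simp add: algebra_simps power2_eq_square power4_eq_xxxx)
      also have "2 ^ k * 2 ^ k * 2 ^ k * (1/32) ^ k = ((1/2) ^ k * (1/2) ^ k :: real)"
        by (simp flip: power_mult_distrib)
      \<comment> \<open>Rounding 24 up to 25 makes the bound a perfect square.\<close>
      also have "24 * C ^ 4 * ((1/2) ^ k * (1/2) ^ k) \<le> 25 * C ^ 4 * ((1/2) ^ k * (1/2) ^ k)"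
        by (intro mult_right_mono) auto
      also have "\<dots> = ((1/2) ^ k * (5 * C\<^sup>2))\<^sup>2"
        by (simp add: power2_eq_square power4_eq_xxxx algebra_simps)
      finally show "(cmod (h (Suc k) x - h k x))\<^sup>2 \<le> ((1/2) ^ k * (5 * C\<^sup>2))\<^sup>2" .
    qed simp
    moreover have "summable (\<lambda>k. (1/2) ^ k * (5 * C\<^sup>2))"
      by (intro summable_mult2 summable_geometric) simp
    ultimately have "summable (\<lambda>k. h (Suc k) x - h k x)"
      by (rule summable_comparison_test'[rotated])
    then have "convergent (\<lambda>n. \<Sum>k<n. h (Suc k) x - h k x)"
      by (simp add: summable_iff_convergent)
    then have "convergent (\<lambda>n. h 0 x + (h n x - h 0 x))"
      unfolding sum_lessThan_telescope[of "\<lambda>k. h k x"] by (intro convergent_add convergent_const)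
    then show ?case by simp
  qed
  show ?thesis
  proof (rule that)
    show "h k \<in> midhull F k" for k by (rule midhull_antimono[OF h(1) N(1)])
    show "(\<lambda>x. lim (\<lambda>k. h k x)) \<in> borel_measurable M" by (rule borel_measurable_lim_metric) (rule hm)
    show "AE x in M. (\<lambda>k. h k x) \<longlonglongrightarrow> lim (\<lambda>k. h k x)"
      using conv by (simp add: convergent_LIMSEQ_iff)
  qed
qed

section \<open>The circle\<close>

lemma space_circle [simp]: "space circle_measure = sphere 0 1"
  by (simp add: circle_measure_def space_restrict_space)

lemma sets_circle: "sets circle_measure = sets (restrict_space borel (sphere 0 1))"
  by (simp add: circle_measure_def)

lemma measurable_cis_circle:
  "cis \<in> measurable borel (restrict_space borel (sphere 0 1))"
  by (rule measurable_restrict_space2)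
     (auto intro!: borel_measurable_continuous_onI continuous_intros)

interpretation circle: prob_space circle_measure
  unfolding circle_measure_def
  by (rule prob_space.prob_space_distr[OF prob_space_uniform_measure])
     (use measurable_cis_circle in \<open>auto simp: measurable_def\<close>)

lemma measurable_circle_cis:
  fixes f :: "complex \<Rightarrow> 'b :: topological_space"
  assumes "f \<in> borel_measurable circle_measure"
  shows "(\<lambda>t. f (cis t)) \<in> borel_measurable borel"
proof -
  have "f \<in> measurable (restrict_space borel (sphere 0 1)) borel"
    using assms by (simp add: measurable_cong_sets[OF sets_circle refl])
  from measurable_compose[OF measurable_cis_circle this] show ?thesis .
qed

lemma integral_circle:
  fixes f :: "complex \<Rightarrow> real"
  assumes f: "f \<in> borel_measurable circle_measure"
  shows "integral\<^sup>L circle_measure f = (\<integral>t. indicator {0..<2*pi} t * f (cis t) \<partial>lborel) / (2 * pi)"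
proof -
  have f': "f \<in> measurable (restrict_space borel (sphere 0 1)) borel"
    using f by (simp add: measurable_cong_sets[OF sets_circle refl])
  have "integral\<^sup>L circle_measure f = (\<integral>t. f (cis t) \<partial>uniform_measure lborel {0..<2*pi})"
    unfolding circle_measure_def
    by (rule integral_distr[OF _ f']) (use measurable_cis_circle in \<open>auto simp: measurable_def\<close>)
  also have "\<dots> = (\<integral>t. (indicator {0..<2*pi} t / (2 * pi)) * f (cis t) \<partial>lborel)"
  proof -
    have "uniform_measure lborel {0..<2*pi} =
       density lborel (\<lambda>t. ennreal (indicator {0..<2*pi} t / (2 * pi)))"
      unfolding uniform_measure_def
      by (rule density_cong)
         (auto simp: indicator_def divide_ennreal simp flip: ennreal_1 intro!: AE_I2)
    then show ?thesis
      by (simp add: integral_density measurable_circle_cis[OF f])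
  qed
  also have "\<dots> = (\<integral>t. indicator {0..<2*pi} t * f (cis t) / (2 * pi) \<partial>lborel)"
    by simp
  also have "\<dots> = (\<integral>t. indicator {0..<2*pi} t * f (cis t) \<partial>lborel) / (2 * pi)"
    by (rule integral_divide_zero)
  finally show ?thesis .
qed

text \<open>Here the rotation \<open>w\<close> is the variable and the point \<open>z\<close> is
  fixed, as needed for averaging over rotations.\<close>

lemma measurable_reflect:
  assumes z: "z \<in> sphere 0 1"
  shows "(\<lambda>w. cnj w * z) \<in> measurable circle_measure circle_measure"
proof -
  have "(\<lambda>w. cnj w * z) \<in> measurable (restrict_space borel (sphere 0 1)) (restrict_space borel (sphere 0 1))"
    using z
    by (intro measurable_restrict_space2 measurable_restrict_space1 borel_measurable_continuous_onI)
       (auto simp: space_restrict_space norm_mult intro!: continuous_intros)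
  then show ?thesis
    by (simp add: measurable_cong_sets[OF sets_circle sets_circle])
qed

lemma measurable_rotate:
  assumes w: "w \<in> sphere 0 1"
  shows "(\<lambda>z. cnj w * z) \<in> measurable circle_measure circle_measure"
proof -
  have "(\<lambda>z. cnj w * z) \<in> measurable (restrict_space borel (sphere 0 1)) (restrict_space borel (sphere 0 1))"
    using w
    by (intro measurable_restrict_space2 measurable_restrict_space1 borel_measurable_continuous_onI)
       (auto simp: space_restrict_space norm_mult intro!: continuous_intros)
  then show ?thesis
    by (simp add: measurable_cong_sets[OF sets_circle sets_circle])
qed

lemma integrable_Ico_periodic:
  fixes f :: "complex \<Rightarrow> real"
  assumes f: "f \<in> borel_measurable circle_measure" and B: "\<And>z. \<bar>f z\<bar> \<le> B"
    and S: "S \<in> sets lborel" "emeasure lborel S < \<infinity>"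
  shows "integrable lborel (\<lambda>t. indicator S t * f (cis t))"
proof (rule Bochner_Integration.integrable_bound)
  show "integrable lborel (\<lambda>t. indicator S t * B)"
    using S by (intro integrable_mult_left integrable_real_indicator) auto
  show "AE t in lborel. norm (indicator S t * f (cis t)) \<le> norm (indicator S t * B)"
  proof (rule AE_I2)
    fix t
    show "norm (indicator S t * f (cis t)) \<le> norm (indicator S t * B)"
      using B[of "cis t"] by (auto simp: indicator_def)
  qed
qed (use S measurable_circle_cis[OF f] in measurable)

text \<open>In angles the map is \<open>t \<mapsto> \<theta> - t\<close>, which carries the window
  \<open>[0, 2 pi)\<close> to \<open>(\<theta> - 2 pi, \<theta>]\<close>; the negative part is moved
  back by one period. This identifies the mean of \<open>f (cnj w * z)\<close> over all rotations
  \<open>w\<close>.\<close>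

lemma integral_circle_reflect:
  fixes f :: "complex \<Rightarrow> real"
  assumes f: "f \<in> borel_measurable circle_measure" and B: "\<And>z. \<bar>f z\<bar> \<le> B"
    and z: "z \<in> sphere 0 1"
  shows "(\<integral>w. f (cnj w * z) \<partial>circle_measure) = integral\<^sup>L circle_measure f"
proof -
  obtain \<theta> where \<theta>: "0 \<le> \<theta>" "\<theta> < 2 * pi" "z = cis \<theta>"
  proof -
    have "cmod z = 1" using z by simp
    then obtain t where "0 \<le> t" "t < 2*pi" "z = cis t"
      by (metis cis_conv_exp complex_unimodular_polar cis.ctr)
    then show ?thesis using that by blast
  qed
  have fm: "(\<lambda>w. f (cnj w * z)) \<in> borel_measurable circle_measure"
    using measurable_compose[OF measurable_reflect[OF z] f] .
  let ?g = "\<lambda>S t. indicator S t * f (cis t) :: real"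
  note int = integrable_Ico_periodic[OF f B]
  have "(\<integral>t. indicator {0..<2*pi} t * f (cnj (cis t) * z) \<partial>lborel)
      = (\<integral>t. indicator {\<theta>-2*pi<..\<theta>} (\<theta> + (-1) * t) * f (cis (\<theta> + (-1) * t)) \<partial>lborel)"
    by (rule Bochner_Integration.integral_cong)
       (auto simp: \<theta> cis_cnj cis_mult indicator_def algebra_simps)
  also have "\<dots> = (\<integral>t. ?g {\<theta>-2*pi<..\<theta>} t \<partial>lborel)"
    using lborel_integral_real_affine[of "-1" "?g {\<theta>-2*pi<..\<theta>}" \<theta>] by simp
  also have "\<dots> = (\<integral>t. ?g {\<theta>-2*pi<..<0} t + ?g {0..\<theta>} t \<partial>lborel)"
    by (rule Bochner_Integration.integral_cong) (use \<theta> in \<open>auto simp: indicator_def\<close>)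
  also have "\<dots> = (\<integral>t. ?g {\<theta>-2*pi<..<0} t \<partial>lborel) + (\<integral>t. ?g {0..\<theta>} t \<partial>lborel)"
    by (rule Bochner_Integration.integral_add) (rule int; use \<theta> in simp)+
  also have "(\<integral>t. ?g {\<theta>-2*pi<..<0} t \<partial>lborel) = (\<integral>t. ?g {\<theta>-2*pi<..<0} ((-2*pi) + 1 * t) \<partial>lborel)"
    using lborel_integral_real_affine[of "1" "?g {\<theta>-2*pi<..<0}" "-2*pi"] by simp
  also have "\<dots> = (\<integral>t. ?g {\<theta><..<2*pi} t \<partial>lborel)"
  proof (rule Bochner_Integration.integral_cong)
    fix t :: real
    have "cis (-2*pi + 1*t) = cis t"
      using cis_mult[of "-2*pi" t] by (simp add: cis.code complex_eq_iff)
    then show "?g {\<theta>-2*pi<..<0} ((-2*pi) + 1 * t) = ?g {\<theta><..<2*pi} t"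
      by (auto simp: indicator_def)
  qed simp
  also have "(\<integral>t. ?g {\<theta><..<2*pi} t \<partial>lborel) + (\<integral>t. ?g {0..\<theta>} t \<partial>lborel)
     = (\<integral>t. ?g {\<theta><..<2*pi} t + ?g {0..\<theta>} t \<partial>lborel)"
    by (rule Bochner_Integration.integral_add[symmetric]) (rule int; use \<theta> in simp)+
  also have "\<dots> = (\<integral>t. ?g {0..<2*pi} t \<partial>lborel)"
    by (rule Bochner_Integration.integral_cong) (use \<theta> in \<open>auto simp: indicator_def\<close>)
  finally show ?thesis
    by (simp add: integral_circle[OF f] integral_circle[OF fm])
qed

section \<open>Seminorms on bounded functions\<close>

lemma measure_circle_tendsto_0:
  fixes h :: "nat \<Rightarrow> complex \<Rightarrow> complex"
  assumes h [measurable]: "\<And>n. h n \<in> borel_measurable circle_measure"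
    and lim: "AE z in circle_measure. (\<lambda>n. h n z) \<longlonglongrightarrow> 0" and "0 < \<delta>"
  shows "(\<lambda>n. measure circle_measure {z \<in> space circle_measure. cmod (h n z) > \<delta>}) \<longlonglongrightarrow> 0"
proof -
  have "(\<lambda>n. \<integral>z. indicator {z. cmod (h n z) > \<delta>} z \<partial>circle_measure) \<longlonglongrightarrow> (\<integral>z. 0 \<partial>circle_measure :: real)"
  proof (rule integral_dominated_convergence[where w = "\<lambda>z. 1"])
    show "AE z in circle_measure. (\<lambda>n. indicator {z. cmod (h n z) > \<delta>} z :: real) \<longlonglongrightarrow> 0"
      using lim
    proof eventually_elim
      case (elim z)
      from tendstoD[OF this \<open>0 < \<delta>\<close>] show ?case
        by (intro tendsto_eventually) (auto elim!: eventually_mono)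
    qed
  qed auto
  moreover have "(\<integral>z. indicator {z. cmod (h n z) > \<delta>} z \<partial>circle_measure) =
     measure circle_measure {z \<in> space circle_measure. cmod (h n z) > \<delta>}" for n
    by (simp add: Int_def conj_commute)
  ultimately show ?thesis by simp
qed

section \<open>The algebra of essentially bounded functions\<close>

lemma LinftyI:
  assumes "f \<in> borel_measurable circle_measure" "AE z in circle_measure. cmod (f z) \<le> C"
  shows "f \<in> Linfty"
  using assms by (auto simp: Linfty_def)

lemma LinftyE:
  assumes "f \<in> Linfty"
  obtains C where "C \<ge> 0" "AE z in circle_measure. cmod (f z) \<le> C"
proof -
  obtain C where C: "AE z in circle_measure. cmod (f z) \<le> C"
    using assms by (auto simp: Linfty_def)
  then have "AE z in circle_measure. cmod (f z) \<le> max C 0"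
    by (auto elim: eventually_mono)
  then show ?thesis using that[of "max C 0"] by auto
qed

lemma Linfty_measurable [measurable_dest]: "f \<in> Linfty \<Longrightarrow> f \<in> borel_measurable circle_measure"
  by (simp add: Linfty_def)

lemma Linfty_const: "(\<lambda>z. c) \<in> Linfty"
  by (rule LinftyI[of _ "cmod c"]) auto

lemma Linfty_add:
  assumes "f \<in> Linfty" "g \<in> Linfty"
  shows "(\<lambda>z. f z + g z) \<in> Linfty"
proof -
  obtain C D where "AE z in circle_measure. cmod (f z) \<le> C"
    "AE z in circle_measure. cmod (g z) \<le> D" 
    using LinftyE[OF assms(1)] LinftyE[OF assms(2)] by metis
  then have "AE z in circle_measure. cmod (f z + g z) \<le> C + D"
    by eventually_elim (meson add_mono norm_triangle_ineq order_trans)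
  then show ?thesis using assms by (auto intro!: LinftyI dest: Linfty_measurable)
qed

lemma Linfty_mult:
  assumes "f \<in> Linfty" "g \<in> Linfty"
  shows "(\<lambda>z. f z * g z) \<in> Linfty"
proof -
  obtain C D where "AE z in circle_measure. cmod (f z) \<le> C"
    "AE z in circle_measure. cmod (g z) \<le> D" 
    using LinftyE[OF assms(1)] LinftyE[OF assms(2)] by metis
  then have "AE z in circle_measure. cmod (f z * g z) \<le> C * D"
    by eventually_elim (auto simp: norm_mult intro!: mult_mono intro: order_trans[OF norm_ge_zero])
  then show ?thesis using assms by (auto intro!: LinftyI dest: Linfty_measurable)
qed

lemma Linfty_cmult: "f \<in> Linfty \<Longrightarrow> (\<lambda>z. c * f z) \<in> Linfty"
  using Linfty_mult[OF Linfty_const] .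

lemma Linfty_diff: "f \<in> Linfty \<Longrightarrow> g \<in> Linfty \<Longrightarrow> (\<lambda>z. f z - g z) \<in> Linfty"
  using Linfty_add[OF _ Linfty_cmult[of g "-1"], of f] by simp

lemma Linfty_sum:
  "(\<And>i. i \<in> I \<Longrightarrow> f i \<in> Linfty) \<Longrightarrow> (\<lambda>z. \<Sum>i\<in>I. f i z) \<in> Linfty"
  by (induction I rule: infinite_finite_induct) (auto intro: Linfty_const Linfty_add)

lemma Linfty_indicator: "E \<in> sets circle_measure \<Longrightarrow> indicator E \<in> Linfty"
  by (rule LinftyI[of _ 1]) (auto simp: indicator_def)

lemma Linfty_of_real_cmod: "f \<in> Linfty \<Longrightarrow> (\<lambda>z. of_real (cmod (f z))) \<in> Linfty"
  by (auto simp: Linfty_def)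

lemma Linfty_min:
  assumes "f \<in> borel_measurable circle_measure"
  shows "(\<lambda>z. of_real (min (cmod (f z)) C)) \<in> Linfty"
  by (rule LinftyI[of _ "\<bar>C\<bar>"]) (use assms in \<open>auto simp: min_def\<close>)

lemma Linfty_simple:
  assumes "simple_function circle_measure s"
  shows "s \<in> Linfty"
proof (rule LinftyI)
  show "s \<in> borel_measurable circle_measure"
    using assms by (rule borel_measurable_simple_function)
  have "finite (s ` space circle_measure)"
    using assms by (rule simple_functionD)
  then have "\<forall>z\<in>space circle_measure. cmod (s z) \<le> Max (cmod ` s ` space circle_measure)"
    by (auto intro!: Max_ge)
  then show "AE z in circle_measure. cmod (s z) \<le> Max (cmod ` s ` space circle_measure)"
    by (auto intro: AE_I2)
qed

section \<open>Monotonicity and continuity of a seminorm in \<open>Rc\<close>\<close>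

locale Rc_norm =
  fixes \<alpha> :: "(complex \<Rightarrow> complex) \<Rightarrow> real"
  assumes Rc: "\<alpha> \<in> Rc"
begin

lemma
  shows \<alpha>_cong: "f \<in> Linfty \<Longrightarrow> g \<in> Linfty \<Longrightarrow> (AE z in circle_measure. f z = g z) \<Longrightarrow> \<alpha> f = \<alpha> g"
    and \<alpha>_nonneg: "f \<in> Linfty \<Longrightarrow> 0 \<le> \<alpha> f"
    and \<alpha>_add: "f \<in> Linfty \<Longrightarrow> g \<in> Linfty \<Longrightarrow> \<alpha> (\<lambda>z. f z + g z) \<le> \<alpha> f + \<alpha> g"
    and \<alpha>_cmult: "f \<in> Linfty \<Longrightarrow> \<alpha> (\<lambda>z. c * f z) = cmod c * \<alpha> f"
    and \<alpha>_one: "\<alpha> (\<lambda>z. 1) = 1"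
    and \<alpha>_cmod: "f \<in> Linfty \<Longrightarrow> \<alpha> (\<lambda>z. of_real (cmod (f z))) = \<alpha> f"
    and \<alpha>_rotate: "f \<in> Linfty \<Longrightarrow> w \<in> sphere 0 1 \<Longrightarrow> \<alpha> (rotate_fun w f) = \<alpha> f"
  using Rc unfolding Rc_def seminorm_on_Linfty_def by blast+

lemma \<alpha>_const: "\<alpha> (\<lambda>z. c) = cmod c"
  using \<alpha>_cmult[OF Linfty_const, of c 1] \<alpha>_one by simp

text \<open>A number in \<open>[0, 1]\<close> is the mean of two unimodular ones, and \<open>\<alpha>\<close> ignores unimodular factors.\<close>

lemma \<alpha>_mono:
  assumes f: "f \<in> Linfty" and g: "g \<in> Linfty"
    and le: "AE z in circle_measure. cmod (f z) \<le> cmod (g z)"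
  shows "\<alpha> f \<le> \<alpha> g"
proof -
  \<comment> \<open>On the null set where \<open>|f|\<close> exceeds \<open>|g|\<close> the value 0
    keeps \<open>r\<close> in \<open>[0, 1]\<close>. In the other branch, \<open>g z = 0\<close>
    forces \<open>f z = 0\<close>, and division by zero gives 0.\<close>
  define r where "r z = (if cmod (f z) \<le> cmod (g z) then cmod (f z) / cmod (g z) else 0)" for z
  define u where "u z = Complex (r z) (sqrt (1 - (r z)\<^sup>2))" for z
  have r: "0 \<le> r z" "r z \<le> 1" for z
    by (auto simp: r_def divide_le_eq_1)
  then have u: "cmod (u z) = 1" for z
    by (simp add: u_def cmod_def power_le_one)
  have [measurable]: "f \<in> borel_measurable circle_measure" "g \<in> borel_measurable circle_measure"
    using f g by (simp_all add: Linfty_measurable)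
  have [measurable]: "r \<in> borel_measurable circle_measure"
    unfolding r_def by measurable
  have "u = (\<lambda>z. of_real (r z) + \<i> * of_real (sqrt (1 - (r z)\<^sup>2)))"
    by (auto simp: u_def complex_eq_iff)
  then have [measurable]: "u \<in> borel_measurable circle_measure"
    by simp
  define h where "h z = u z * of_real (cmod (g z))" for z
  define k where "k z = cnj (u z) * of_real (cmod (g z))" for z
  have [measurable]: "(\<lambda>z. cnj (u z)) \<in> borel_measurable circle_measure"
    by (rule measurable_compose[OF _ borel_measurable_continuous_onI]) (auto intro: continuous_intros)
  have uL: "u \<in> Linfty" "(\<lambda>z. cnj (u z)) \<in> Linfty"
    using u by (auto intro!: LinftyI[of _ 1])
  have hL: "h \<in> Linfty" "k \<in> Linfty"
    unfolding h_def k_def using uL g by (auto intro: Linfty_mult Linfty_of_real_cmod)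
  have "\<alpha> h = \<alpha> (\<lambda>z. of_real (cmod (h z)))" "\<alpha> k = \<alpha> (\<lambda>z. of_real (cmod (k z)))"
    using \<alpha>_cmod hL by auto
  moreover have "cmod (h z) = cmod (g z)" "cmod (k z) = cmod (g z)" for z
    by (simp_all add: h_def k_def norm_mult u)
  ultimately have hk: "\<alpha> h = \<alpha> g" "\<alpha> k = \<alpha> g"
    using \<alpha>_cmod[OF g] by auto
  have "AE z in circle_measure. 2 * of_real (cmod (f z)) = h z + k z"
    using le
  proof eventually_elim
    case (elim z)
    have "u z + cnj (u z) = of_real (2 * r z)"
      by (simp add: u_def complex_eq_iff)
    then have "h z + k z = of_real (2 * r z) * of_real (cmod (g z))"
      by (simp add: h_def k_def flip: distrib_right)
    moreover have "r z * cmod (g z) = cmod (f z)"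
      using elim by (auto simp: r_def)
    ultimately show ?case by (metis mult.assoc of_real_mult of_real_numeral)
  qed
  then have "\<alpha> (\<lambda>z. 2 * of_real (cmod (f z))) = \<alpha> (\<lambda>z. h z + k z)"
    by (rule \<alpha>_cong[OF Linfty_cmult[OF Linfty_of_real_cmod[OF f]] Linfty_add[OF hL]])
  also have "\<dots> \<le> 2 * \<alpha> g"
    using \<alpha>_add[OF hL] hk by simp
  finally show ?thesis
    using \<alpha>_cmult[OF Linfty_of_real_cmod[OF f], of 2] \<alpha>_cmod[OF f] by simp
qed

lemma \<alpha>_le_bound:
  assumes "f \<in> Linfty" "AE z in circle_measure. cmod (f z) \<le> C" "0 \<le> C"
  shows "\<alpha> f \<le> C"
proof -
  have "\<alpha> f \<le> \<alpha> (\<lambda>z. of_real C)"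
  proof (rule \<alpha>_mono[OF assms(1) Linfty_const])
    show "AE z in circle_measure. cmod (f z) \<le> cmod (of_real C)"
      using assms(2,3) by simp
  qed
  also have "\<dots> = C"
    using \<alpha>_const assms(3) by simp
  finally show ?thesis .
qed

lemma \<alpha>_indicator_small:
  assumes "0 < \<epsilon>"
  obtains \<delta> where "0 < \<delta>"
    "\<And>E. E \<in> sets circle_measure \<Longrightarrow> measure circle_measure E < \<delta> \<Longrightarrow> \<alpha> (indicator E) < \<epsilon>"
proof -
  have "((\<lambda>E. \<alpha> (indicator E)) \<longlongrightarrow> 0)
       (inf (filtercomap (measure circle_measure) (at_right 0)) (principal (sets circle_measure)))"
    using Rc by (auto simp: Rc_def)
  then have "eventually (\<lambda>E. dist (\<alpha> (indicator E)) 0 < \<epsilon>)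
     (inf (filtercomap (measure circle_measure) (at_right 0)) (principal (sets circle_measure)))"
    using assms by (rule tendstoD)
  then obtain \<delta> where \<delta>: "\<delta> > 0"
    "\<And>E. 0 < measure circle_measure E \<Longrightarrow> measure circle_measure E < \<delta> \<Longrightarrow>
        E \<in> sets circle_measure \<Longrightarrow> \<bar>\<alpha> (indicator E)\<bar> < \<epsilon>"
    by (auto simp: eventually_inf_principal eventually_filtercomap eventually_at_right_field)
  show ?thesis
  proof (rule that[OF \<delta>(1)])
    fix E assume E: "E \<in> sets circle_measure" "measure circle_measure E < \<delta>"
    show "\<alpha> (indicator E) < \<epsilon>"
    \<comment> \<open>The filter \<open>at_right 0\<close> says nothing about null sets; there the
      indicator vanishes a.e.\<close>
    proof (cases "measure circle_measure E = 0")
      case True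
      then have "AE z in circle_measure. z \<notin> E"
        using E(1) by (intro AE_not_in null_setsI) (simp_all add: circle.emeasure_eq_measure)
      then have "\<alpha> (indicator E) \<le> 0"
        using E by (intro \<alpha>_le_bound Linfty_indicator) auto
      then show ?thesis using assms by simp
    next
      case False
      then show ?thesis
        using \<delta>(2)[of E] E measure_nonneg[of circle_measure E] by linarith
    qed
  qed
qed

text \<open>On uniformly bounded functions \<alpha> is continuous at 0 for convergence in measure,
  because \<open>|h|\<close> is at most \<open>\<epsilon>/2\<close> plus \<open>B\<close> times the
  indicator of the set where it is large. A single \<open>\<delta>\<close> serves as height and as
  measure bound.\<close>

lemma \<alpha>_small:
  assumes "0 < \<epsilon>" "0 \<le> B"
  obtains \<delta> where "0 < \<delta>"
    "\<And>h. h \<in> Linfty \<Longrightarrow> (AE z in circle_measure. cmod (h z) \<le> B) \<Longrightarrow>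
       measure circle_measure {z \<in> space circle_measure. cmod (h z) > \<delta>} < \<delta> \<Longrightarrow> \<alpha> h < \<epsilon>"
proof -
  obtain \<delta> where \<delta>: "0 < \<delta>" "\<And>E. E \<in> sets circle_measure \<Longrightarrow>
      measure circle_measure E < \<delta> \<Longrightarrow> \<alpha> (indicator E) < \<epsilon> / (2 * (B + 1))"
    using \<alpha>_indicator_small[of "\<epsilon> / (2 * (B + 1))"] assms by auto
  show ?thesis
  proof (rule that)
    show "0 < min \<delta> (\<epsilon>/2)" using \<delta> assms by simp
  next
    fix h assume h: "h \<in> Linfty" "AE z in circle_measure. cmod (h z) \<le> B"
      and m: "measure circle_measure {z \<in> space circle_measure. cmod (h z) > min \<delta> (\<epsilon>/2)} < min \<delta> (\<epsilon>/2)"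
    define E where "E = {z \<in> space circle_measure. cmod (h z) > min \<delta> (\<epsilon>/2)}"
    have E: "E \<in> sets circle_measure"
      unfolding E_def using Linfty_measurable[OF h(1)] by measurable
    have EL: "(\<lambda>z. of_real B * indicator E z) \<in> Linfty"
      using E by (intro Linfty_cmult Linfty_indicator)
    have "AE z in circle_measure. cmod (h z) \<le> cmod (of_real (\<epsilon>/2) + of_real B * indicator E z)"
      using h(2) AE_space
    proof eventually_elim
      case (elim z)
      show ?case
      proof (cases "z \<in> E")
        case True
        then have "of_real (\<epsilon>/2) + of_real B * indicator E z = (of_real (\<epsilon>/2 + B) :: complex)"
          by simp
        then have "cmod (of_real (\<epsilon>/2) + of_real B * indicator E z) = \<epsilon>/2 + B"
          using assms by (simp only: norm_of_real)
        then show ?thesis using elim assms by simp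
      next
        case False
        then have "cmod (h z) \<le> \<epsilon>/2"
          using elim by (auto simp: E_def not_less)
        then show ?thesis using False assms by simp
      qed
    qed
    then have "\<alpha> h \<le> \<alpha> (\<lambda>z. of_real (\<epsilon>/2) + of_real B * indicator E z)"
      by (intro \<alpha>_mono h Linfty_add Linfty_const EL)
    also have "\<dots> \<le> \<epsilon>/2 + B * \<alpha> (indicator E)"
      using \<alpha>_add[OF Linfty_const EL, of "of_real (\<epsilon>/2)"] \<alpha>_const[of "of_real (\<epsilon>/2)"]
        \<alpha>_cmult[OF Linfty_indicator[OF E], of "of_real B"] assms by simp
    also have "B * \<alpha> (indicator E) \<le> B * (\<epsilon> / (2 * (B + 1)))"
      using \<delta>(2)[OF E] m assms by (intro mult_left_mono) (auto simp: E_def)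
    also have "\<epsilon>/2 + B * (\<epsilon> / (2 * (B + 1))) < \<epsilon>"
      using assms by (simp add: field_simps)
    finally show "\<alpha> h < \<epsilon>" by simp
  qed
qed

text \<open>Bounded convergence for \<alpha>: on a finite measure space a.e. convergence implies
  convergence in measure, to which \<open>\<alpha>_small\<close> applies.\<close>

lemma \<alpha>_tendsto_0:
  assumes h: "\<And>n. h n \<in> Linfty" and B: "\<And>n. AE z in circle_measure. cmod (h n z) \<le> B"
    and lim: "AE z in circle_measure. (\<lambda>n. h n z) \<longlonglongrightarrow> 0"
  shows "(\<lambda>n. \<alpha> (h n)) \<longlonglongrightarrow> 0"
proof (rule LIMSEQ_I)
  fix \<epsilon> :: real assume "0 < \<epsilon>"
  have "AE z in circle_measure. 0 \<le> B"
    using B[of 0] by eventually_elim (auto intro: order_trans[OF norm_ge_zero])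
  then have "0 \<le> B" by simp
  obtain \<delta> where \<delta>: "0 < \<delta>"
    "\<And>h. h \<in> Linfty \<Longrightarrow> (AE z in circle_measure. cmod (h z) \<le> B) \<Longrightarrow>
       measure circle_measure {z \<in> space circle_measure. cmod (h z) > \<delta>} < \<delta> \<Longrightarrow> \<alpha> h < \<epsilon>"
    using \<alpha>_small[OF \<open>0 < \<epsilon>\<close> \<open>0 \<le> B\<close>] by blast
  have [measurable]: "h n \<in> borel_measurable circle_measure" for n
    using h by (rule Linfty_measurable)
  have "(\<lambda>n. measure circle_measure {z \<in> space circle_measure. cmod (h n z) > \<delta>}) \<longlonglongrightarrow> 0"
    by (rule measure_circle_tendsto_0[OF _ lim \<delta>(1)]) measurable
  then have "eventually (\<lambda>n. measure circle_measure {z \<in> space circle_measure. cmod (h n z) > \<delta>} < \<delta>) sequentially"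
    using \<delta>(1) by (auto dest: order_tendstoD(2))
  then show "\<exists>no. \<forall>n\<ge>no. norm (\<alpha> (h n) - 0) < \<epsilon>"
    using \<delta>(2)[OF h B] \<alpha>_nonneg[OF h] by (auto simp: eventually_sequentially)
qed

end

section \<open>The extended norm\<close>

context Rc_norm
begin

lemma ext_norm_mono:
  assumes "AE z in circle_measure. cmod (f z) \<le> cmod (g z)"
  shows "ext_norm \<alpha> f \<le> ext_norm \<alpha> g"
  unfolding ext_norm_def
proof (rule SUP_subset_mono)
  show "{s. simple_function circle_measure s \<and> (AE z in circle_measure. cmod (s z) \<le> cmod (f z))}
    \<subseteq> {s. simple_function circle_measure s \<and> (AE z in circle_measure. cmod (s z) \<le> cmod (g z))}"
    using assms by (auto elim: eventually_elim2)
qed simp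

text \<open>Together with \<open>ext_norm_ge\<close> this replaces simple test functions by bounded
  ones in the definition of \<open>ext_norm\<close>, so that later arguments may use truncations and
  minima freely.\<close>

lemma ext_norm_leI:
  assumes "\<And>s. s \<in> Linfty \<Longrightarrow> AE z in circle_measure. cmod (s z) \<le> cmod (f z) \<Longrightarrow> ennreal (\<alpha> s) \<le> K"
  shows "ext_norm \<alpha> f \<le> K"
  unfolding ext_norm_def by (rule SUP_least) (auto intro: assms Linfty_simple)

text \<open>Quantising \<open>|f|\<close> to multiples of \<open>\<epsilon>\<close> gives the simple functions needed for the lower bound.\<close>

lemma ext_norm_Linfty:
  assumes f: "f \<in> Linfty"
  shows "ext_norm \<alpha> f = ennreal (\<alpha> f)"
proof (rule antisym)
  show "ext_norm \<alpha> f \<le> ennreal (\<alpha> f)"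
    by (rule ext_norm_leI) (auto intro!: ennreal_leI \<alpha>_mono f)
next
  obtain C where C: "0 \<le> C" "AE z in circle_measure. cmod (f z) \<le> C"
    using LinftyE[OF f] by blast
  have [measurable]: "f \<in> borel_measurable circle_measure"
    using f by (rule Linfty_measurable)
  show "ennreal (\<alpha> f) \<le> ext_norm \<alpha> f"
  proof (rule ennreal_le_epsilon)
    fix \<epsilon> :: real assume \<epsilon>: "0 < \<epsilon>"
    \<comment> \<open>\<open>C\<close> bounds \<open>|f|\<close> only almost everywhere; capping at
      \<open>C\<close> makes \<open>s\<close> take finitely many values at every point.\<close>
    define k where "k z = \<lfloor>min (cmod (f z)) C / \<epsilon>\<rfloor>" for z
    define s :: "complex \<Rightarrow> complex" where "s z = of_real (\<epsilon> * of_int (k z))" for z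
    have k: "0 \<le> k z" "\<epsilon> * of_int (k z) \<le> min (cmod (f z)) C"
      "min (cmod (f z)) C \<le> \<epsilon> * of_int (k z) + \<epsilon>" for z
    proof -
      show "0 \<le> k z" using C \<epsilon> by (simp add: k_def)
      show "\<epsilon> * of_int (k z) \<le> min (cmod (f z)) C"
        using \<epsilon> of_int_floor_le[of "min (cmod (f z)) C / \<epsilon>"]
        by (simp only: k_def pos_le_divide_eq mult.commute)
      have "min (cmod (f z)) C / \<epsilon> \<le> of_int (k z) + 1"
        unfolding k_def by (rule real_of_int_floor_add_one_ge)
      then show "min (cmod (f z)) C \<le> \<epsilon> * of_int (k z) + \<epsilon>"
        using \<epsilon> by (simp only: pos_divide_le_eq) (simp add: algebra_simps)
    qed
    have "k z \<in> {0..\<lfloor>C / \<epsilon>\<rfloor>}" for z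
      using k(1)[of z] \<epsilon> by (auto simp: k_def intro!: floor_mono divide_right_mono)
    then have "finite (range k)"
      by (intro finite_subset[of "range k" "{0..\<lfloor>C / \<epsilon>\<rfloor>}"]) auto
    then have "finite ((\<lambda>i. complex_of_real (\<epsilon> * of_int i)) ` range k)"
      by (rule finite_imageI)
    then have fin: "finite (s ` space circle_measure)"
      by (rule rev_finite_subset) (auto simp: s_def)
    have s: "simple_function circle_measure s"
    proof (rule simple_function_borel_measurable[OF _ fin])
      show "s \<in> borel_measurable circle_measure"
        unfolding s_def k_def by measurable
    qed
    have sf: "cmod (s z) \<le> cmod (f z)" for z
      unfolding s_def norm_of_real using k[of z] \<epsilon> by simp
    have "AE z in circle_measure. cmod (f z) \<le> cmod (s z + of_real \<epsilon>)"
      using C(2)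
    proof eventually_elim
      case (elim z)
      have "s z + of_real \<epsilon> = of_real (\<epsilon> * of_int (k z) + \<epsilon>)"
        by (simp add: s_def)
      then have "cmod (s z + of_real \<epsilon>) = \<epsilon> * of_int (k z) + \<epsilon>"
        using k(1)[of z] \<epsilon> by (simp only: norm_of_real) simp
      then show ?case using k(3)[of z] elim by simp
    qed
    then have "\<alpha> f \<le> \<alpha> (\<lambda>z. s z + of_real \<epsilon>)"
      by (rule \<alpha>_mono[OF f Linfty_add[OF Linfty_simple[OF s] Linfty_const]])
    also have "\<dots> \<le> \<alpha> s + \<epsilon>"
      using \<alpha>_add[OF Linfty_simple[OF s] Linfty_const[of "of_real \<epsilon>"]] \<alpha>_const[of "of_real \<epsilon>"] \<epsilon>
      by simp
    finally have "ennreal (\<alpha> f) \<le> ennreal (\<alpha> s) + ennreal \<epsilon>"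
      using \<epsilon> \<alpha>_nonneg[OF Linfty_simple[OF s]] by (simp flip: ennreal_plus)
    also have "ennreal (\<alpha> s) \<le> ext_norm \<alpha> f"
      unfolding ext_norm_def using s sf by (intro SUP_upper) auto
    finally show "ennreal (\<alpha> f) \<le> ext_norm \<alpha> f + ennreal \<epsilon>"
      by (simp add: add_mono)
  qed
qed

lemma ext_norm_ge:
  assumes "s \<in> Linfty" "AE z in circle_measure. cmod (s z) \<le> cmod (f z)"
  shows "ennreal (\<alpha> s) \<le> ext_norm \<alpha> f"
  using ext_norm_mono[OF assms(2)] ext_norm_Linfty[OF assms(1)] by simp

lemma ext_norm_cong:
  assumes "AE z in circle_measure. cmod (f z) = cmod (g z)"
  shows "ext_norm \<alpha> f = ext_norm \<alpha> g"
  by (intro antisym ext_norm_mono) (use assms in \<open>auto elim: eventually_mono\<close>)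

text \<open>A test function \<open>s\<close> bounded by \<open>C\<close> lies below the sum of the
  truncations of \<open>|f|\<close> and \<open>|g|\<close> at height \<open>C\<close>, which reduces
  the claim to subadditivity of \<alpha> on bounded functions.\<close>

lemma ext_norm_add:
  assumes f: "f \<in> borel_measurable circle_measure" and g: "g \<in> borel_measurable circle_measure"
  shows "ext_norm \<alpha> (\<lambda>z. f z + g z) \<le> ext_norm \<alpha> f + ext_norm \<alpha> g"
proof (rule ext_norm_leI)
  fix s assume s: "s \<in> Linfty" and le: "AE z in circle_measure. cmod (s z) \<le> cmod (f z + g z)"
  obtain C where C: "0 \<le> C" "AE z in circle_measure. cmod (s z) \<le> C"
    using LinftyE[OF s] by blast
  define f' g' :: "complex \<Rightarrow> complex"
    where "f' z = of_real (min (cmod (f z)) C)" and "g' z = of_real (min (cmod (g z)) C)" for z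
  have L: "f' \<in> Linfty" "g' \<in> Linfty"
    unfolding f'_def g'_def using f g by (auto intro: Linfty_min)
  have "AE z in circle_measure. cmod (s z) \<le> cmod (f' z + g' z)"
    using le C(2)
  proof eventually_elim
    case (elim z)
    have "f' z + g' z = of_real (min (cmod (f z)) C + min (cmod (g z)) C)"
      by (simp add: f'_def g'_def)
    then have "cmod (f' z + g' z) = min (cmod (f z)) C + min (cmod (g z)) C"
      using C(1) by (simp only: norm_of_real) simp
    moreover have "cmod (f z + g z) \<le> cmod (f z) + cmod (g z)"
      by (rule norm_triangle_ineq)
    ultimately show ?case
      using elim C(1) norm_ge_zero[of "f z"] norm_ge_zero[of "g z"] by linarith
  qed
  then have "\<alpha> s \<le> \<alpha> (\<lambda>z. f' z + g' z)"
    by (rule \<alpha>_mono[OF s Linfty_add[OF L]])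
  also have "\<dots> \<le> \<alpha> f' + \<alpha> g'"
    by (rule \<alpha>_add[OF L])
  finally have "ennreal (\<alpha> s) \<le> ennreal (\<alpha> f') + ennreal (\<alpha> g')"
    using \<alpha>_nonneg[OF L(1)] \<alpha>_nonneg[OF L(2)] by (simp add: ennreal_leI flip: ennreal_plus)
  also have "\<dots> \<le> ext_norm \<alpha> f + ext_norm \<alpha> g"
    using C by (intro add_mono ext_norm_ge L) (auto simp: f'_def g'_def)
  finally show "ennreal (\<alpha> s) \<le> ext_norm \<alpha> f + ext_norm \<alpha> g" .
qed

lemma ext_norm_zero [simp]: "ext_norm \<alpha> (\<lambda>z. 0) = 0"
  using ext_norm_Linfty[OF Linfty_const[of 0]] \<alpha>_const[of 0] by simp

lemma ext_norm_cmult: "ext_norm \<alpha> (\<lambda>z. c * f z) = ennreal (cmod c) * ext_norm \<alpha> f"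
proof -
  have le: "ext_norm \<alpha> (\<lambda>z. c * f z) \<le> ennreal (cmod c) * ext_norm \<alpha> f" if "c \<noteq> 0" for c f
  proof (rule ext_norm_leI)
    fix s assume s: "s \<in> Linfty" and "AE z in circle_measure. cmod (s z) \<le> cmod (c * f z)"
    then have "AE z in circle_measure. cmod (inverse c * s z) \<le> cmod (f z)"
      using \<open>c \<noteq> 0\<close> by (auto simp: norm_mult norm_divide field_simps elim!: eventually_mono)
    then have "ennreal (\<alpha> (\<lambda>z. inverse c * s z)) \<le> ext_norm \<alpha> f"
      by (rule ext_norm_ge[OF Linfty_cmult[OF s]])
    then have "ennreal (cmod c) * ennreal (\<alpha> (\<lambda>z. inverse c * s z)) \<le> ennreal (cmod c) * ext_norm \<alpha> f"
      by (intro mult_left_mono) auto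
    moreover have "ennreal (cmod c) * ennreal (\<alpha> (\<lambda>z. inverse c * s z)) = ennreal (\<alpha> s)"
      using \<alpha>_cmult[OF s, of "inverse c"] \<open>c \<noteq> 0\<close> \<alpha>_nonneg[OF s]
      by (simp add: norm_inverse flip: ennreal_mult)
    ultimately show "ennreal (\<alpha> s) \<le> ennreal (cmod c) * ext_norm \<alpha> f" by simp
  qed
  show ?thesis
  proof (cases "c = 0")
    case False
    have "ennreal (cmod c) * ext_norm \<alpha> f = ennreal (cmod c) * ext_norm \<alpha> (\<lambda>z. inverse c * (c * f z))"
      using False by (simp add: field_simps)
    also have "\<dots> \<le> ennreal (cmod c) * (ennreal (cmod (inverse c)) * ext_norm \<alpha> (\<lambda>z. c * f z))"
      using False by (intro mult_left_mono le) auto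
    also have "\<dots> = ext_norm \<alpha> (\<lambda>z. c * f z)"
      using False by (simp add: norm_inverse flip: mult.assoc ennreal_mult)
    finally show ?thesis using le[OF False, of f] by simp
  qed simp
qed

text \<open>Fatou's lemma for \<alpha>. For bounded \<open>s\<close> below \<open>|f|\<close> the
  functions \<open>min |s| |F n|\<close> have seminorm at most \<open>K\<close> (for
  \<open>K \<ge> 0\<close>) and converge boundedly to \<open>|s|\<close>, hence also in
  \<alpha>.\<close>

lemma ext_norm_le_of_lim:
  assumes F: "\<And>n. F n \<in> borel_measurable circle_measure"
    and lim: "AE z in circle_measure. (\<lambda>n. F n z) \<longlonglongrightarrow> f z"
    and K: "\<And>n. ext_norm \<alpha> (F n) \<le> ennreal K"
  shows "ext_norm \<alpha> f \<le> ennreal K"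
proof (rule ext_norm_leI)
  fix s assume s: "s \<in> Linfty" and le: "AE z in circle_measure. cmod (s z) \<le> cmod (f z)"
  obtain C where C: "0 \<le> C" "AE z in circle_measure. cmod (s z) \<le> C"
    using LinftyE[OF s] by blast
  note [measurable] = F Linfty_measurable[OF s]
  define g :: "nat \<Rightarrow> complex \<Rightarrow> complex" where "g n z = of_real (min (cmod (s z)) (cmod (F n z)))" for n z
  have gC: "AE z in circle_measure. cmod (g n z) \<le> C" for n
    using C(2) by eventually_elim (auto simp: g_def min_def)
  have gL: "g n \<in> Linfty" for n
    by (rule LinftyI[OF _ gC]) (simp add: g_def)
  let ?d = "\<lambda>n z. of_real (cmod (s z)) - g n z"
  have dL: "?d n \<in> Linfty" for n
    by (intro Linfty_diff Linfty_of_real_cmod s gL)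
  have d0: "(\<lambda>n. \<alpha> (?d n)) \<longlonglongrightarrow> 0"
  proof (rule \<alpha>_tendsto_0[OF dL])
    show "AE z in circle_measure. cmod (?d n z) \<le> C" for n
      using C(2)
    proof eventually_elim
      case (elim z)
      have "?d n z = of_real (cmod (s z) - min (cmod (s z)) (cmod (F n z)))"
        by (simp add: g_def)
      then have "cmod (?d n z) = cmod (s z) - min (cmod (s z)) (cmod (F n z))"
        by (simp only: norm_of_real)
      moreover have "0 \<le> min (cmod (s z)) (cmod (F n z))"
        by simp
      ultimately show ?case
        using elim by linarith
    qed
    show "AE z in circle_measure. (\<lambda>n. ?d n z) \<longlonglongrightarrow> 0"
      using lim le
    proof eventually_elim
      case (elim z)
      have "(\<lambda>n. ?d n z) \<longlonglongrightarrow> of_real (cmod (s z)) - of_real (min (cmod (s z)) (cmod (f z)))"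
        unfolding g_def by (intro tendsto_intros elim)
      then show ?case using elim by (simp add: min_absorb1)
    qed
  qed
  have gK': "ennreal (\<alpha> (g n)) \<le> ennreal K" for n
    by (rule order_trans[OF ext_norm_ge[OF gL] K[of n]]) (auto simp: g_def)
  \<comment> \<open>\<open>ennreal\<close> sends a negative \<open>K\<close> to 0, hence the
    maximum.\<close>
  have gK: "\<alpha> (g n) \<le> max K 0" for n
    using \<alpha>_nonneg[OF gL[of n]] gK'[of n] by (auto simp: ennreal_le_iff2 max_def)
  have "\<alpha> s \<le> \<alpha> (?d n) + max K 0" for n
  proof -
    have "\<alpha> s = \<alpha> (\<lambda>z. ?d n z + g n z)"
      using \<alpha>_cmod[OF s] by simp
    also have "\<dots> \<le> \<alpha> (?d n) + \<alpha> (g n)"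
      by (rule \<alpha>_add[OF dL gL])
    finally show ?thesis using gK[of n] by simp
  qed
  then have "\<alpha> s \<le> 0 + max K 0"
    by (intro LIMSEQ_le_const[OF tendsto_add[OF d0 tendsto_const]]) auto
  then show "ennreal (\<alpha> s) \<le> ennreal K"
    using \<alpha>_nonneg[OF s] by (auto simp: ennreal_le_iff2 max_def split: if_splits)
qed

section \<open>The spaces \<open>calL\<close> and \<open>Lalpha\<close>\<close>

lemma calL_measurable: "f \<in> calL \<alpha> \<Longrightarrow> f \<in> borel_measurable circle_measure"
  by (simp add: calL_def)

lemma calL_add: "f \<in> calL \<alpha> \<Longrightarrow> g \<in> calL \<alpha> \<Longrightarrow> (\<lambda>z. f z + g z) \<in> calL \<alpha>"
  using ext_norm_add[of f g] by (auto simp: calL_def intro: le_less_trans)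

lemma calL_mono:
  assumes "f \<in> calL \<alpha>" "g \<in> borel_measurable circle_measure"
    "AE z in circle_measure. cmod (g z) \<le> cmod (f z)"
  shows "g \<in> calL \<alpha>"
  using assms ext_norm_mono[OF assms(3)] by (auto simp: calL_def intro: le_less_trans)

lemma Linfty_subset_calL: "Linfty \<subseteq> calL \<alpha>"
  by (auto simp: calL_def ext_norm_Linfty Linfty_measurable)

lemma Lalpha_subset_calL: "Lalpha \<alpha> \<subseteq> calL \<alpha>"
  by (auto simp: Lalpha_def)

lemma Linfty_subset_Lalpha: "Linfty \<subseteq> Lalpha \<alpha>"
proof
  fix f assume f: "f \<in> Linfty"
  then have "\<exists>g\<in>Linfty. ext_norm \<alpha> (\<lambda>z. f z - g z) < ennreal \<epsilon>" if "\<epsilon> > 0" for \<epsilon>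
    using that by (intro bexI[OF _ f]) simp
  then show "f \<in> Lalpha \<alpha>"
    using f Linfty_subset_calL by (auto simp: Lalpha_def)
qed

lemma Lalpha_add:
  assumes f: "f \<in> Lalpha \<alpha>" and g: "g \<in> Lalpha \<alpha>"
  shows "(\<lambda>z. f z + g z) \<in> Lalpha \<alpha>"
  unfolding Lalpha_def
proof safe
  show "(\<lambda>z. f z + g z) \<in> calL \<alpha>"
    using f g Lalpha_subset_calL by (auto intro: calL_add)
next
  fix \<epsilon> :: real assume "0 < \<epsilon>"
  then have "0 < \<epsilon> / 2" by simp
  from f this obtain u where u: "u \<in> Linfty" "ext_norm \<alpha> (\<lambda>z. f z - u z) < ennreal (\<epsilon>/2)"
    unfolding Lalpha_def by blast
  from g \<open>0 < \<epsilon>/2\<close> obtain v where v: "v \<in> Linfty" "ext_norm \<alpha> (\<lambda>z. g z - v z) < ennreal (\<epsilon>/2)"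
    unfolding Lalpha_def by blast
  have [measurable]: "f \<in> borel_measurable circle_measure" "g \<in> borel_measurable circle_measure"
    "u \<in> borel_measurable circle_measure" "v \<in> borel_measurable circle_measure"
    using f g u v Lalpha_subset_calL by (auto intro: calL_measurable Linfty_measurable)
  have "ext_norm \<alpha> (\<lambda>z. (f z + g z) - (u z + v z)) = ext_norm \<alpha> (\<lambda>z. (f z - u z) + (g z - v z))"
    by (simp add: algebra_simps)
  also have "\<dots> \<le> ext_norm \<alpha> (\<lambda>z. f z - u z) + ext_norm \<alpha> (\<lambda>z. g z - v z)"
    by (rule ext_norm_add) measurable
  also have "\<dots> < ennreal (\<epsilon>/2) + ennreal (\<epsilon>/2)"
    using u v by (intro add_strict_mono)
  also have "\<dots> = ennreal \<epsilon>"
    using \<open>0 < \<epsilon>\<close> by (simp flip: ennreal_plus)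
  finally show "\<exists>h\<in>Linfty. ext_norm \<alpha> (\<lambda>z. f z + g z - h z) < ennreal \<epsilon>"
    using Linfty_add[OF u(1) v(1)] by auto
qed

text \<open>\<open>Lalpha\<close> is a module over the bounded functions; this is what allows new
  functionals to be built from old ones in \<open>dual_mult\<close>.\<close>

lemma Lalpha_mult:
  assumes f: "f \<in> Lalpha \<alpha>" and u: "u \<in> Linfty"
  shows "(\<lambda>z. u z * f z) \<in> Lalpha \<alpha>"
proof -
  obtain C where C0: "0 \<le> C" "AE z in circle_measure. cmod (u z) \<le> C"
    using LinftyE[OF u] by blast
  \<comment> \<open>The shift by 1 makes the constant positive, so that \<open>\<epsilon>\<close>
    can be divided by it.\<close>
  then have C: "0 < C + 1" "AE z in circle_measure. cmod (u z) \<le> C + 1"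
    by (auto elim: eventually_mono)
  have [measurable]: "f \<in> borel_measurable circle_measure" "u \<in> borel_measurable circle_measure"
    using f u Lalpha_subset_calL by (auto intro: calL_measurable Linfty_measurable)
  have le: "ext_norm \<alpha> (\<lambda>z. u z * h z) \<le> ennreal (C + 1) * ext_norm \<alpha> h" for h
  proof -
    have "ext_norm \<alpha> (\<lambda>z. u z * h z) \<le> ext_norm \<alpha> (\<lambda>z. of_real (C + 1) * h z)"
      using C(2) by (intro ext_norm_mono, eventually_elim) (use C(1) in \<open>auto simp: norm_mult intro!: mult_right_mono simp del: of_real_add\<close>)
    also have "\<dots> = ennreal (C + 1) * ext_norm \<alpha> h"
      using C(1) by (subst ext_norm_cmult) (simp only: norm_of_real abs_of_pos)
    finally show ?thesis .
  qed
  show ?thesis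
    unfolding Lalpha_def
  proof safe
    have "ext_norm \<alpha> f < \<infinity>" using f Lalpha_subset_calL by (auto simp: calL_def)
    then show "(\<lambda>z. u z * f z) \<in> calL \<alpha>"
      using le[of f] by (auto simp: calL_def ennreal_mult_less_top intro: le_less_trans)
  next
    fix \<epsilon> :: real assume "0 < \<epsilon>"
    then have "0 < \<epsilon> / (C + 1)" using C by simp
    with f obtain g where g: "g \<in> Linfty" "ext_norm \<alpha> (\<lambda>z. f z - g z) < ennreal (\<epsilon> / (C + 1))"
      unfolding Lalpha_def by blast
    have "ext_norm \<alpha> (\<lambda>z. u z * f z - u z * g z) \<le> ennreal (C + 1) * ext_norm \<alpha> (\<lambda>z. f z - g z)"
      using le[of "\<lambda>z. f z - g z"] by (simp add: algebra_simps)
    also have "\<dots> < ennreal (C + 1) * ennreal (\<epsilon> / (C + 1))"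
      using g C(1) by (intro ennreal_mult_strict_left_mono) auto
    also have "\<dots> = ennreal \<epsilon>"
      using C(1) \<open>0 < \<epsilon>\<close> by (simp flip: ennreal_mult)
    finally show "\<exists>h\<in>Linfty. ext_norm \<alpha> (\<lambda>z. u z * f z - h z) < ennreal \<epsilon>"
      using Linfty_mult[OF u g(1)] by auto
  qed
qed

lemma Lalpha_cmult: "f \<in> Lalpha \<alpha> \<Longrightarrow> (\<lambda>z. c * f z) \<in> Lalpha \<alpha>"
  using Lalpha_mult[OF _ Linfty_const] .

lemma Lalpha_diff: "f \<in> Lalpha \<alpha> \<Longrightarrow> g \<in> Lalpha \<alpha> \<Longrightarrow> (\<lambda>z. f z - g z) \<in> Lalpha \<alpha>"
  using Lalpha_add[OF _ Lalpha_cmult[of g "-1"], of f] by simp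

lemma Lalpha_cong:
  assumes f: "f \<in> Lalpha \<alpha>" and g: "g \<in> borel_measurable circle_measure"
    and eq: "AE z in circle_measure. f z = g z"
  shows "g \<in> Lalpha \<alpha>"
proof -
  have "g \<in> calL \<alpha>"
    using f Lalpha_subset_calL eq by (intro calL_mono[OF _ g, of f]) auto
  moreover have "ext_norm \<alpha> (\<lambda>z. g z - h z) = ext_norm \<alpha> (\<lambda>z. f z - h z)" for h
    using eq by (intro ext_norm_cong) auto
  ultimately show ?thesis
    using f by (auto simp: Lalpha_def)
qed

text \<open>Absolute continuity of the norm: for bounded \<open>g\<close> it is continuity of
  \<alpha> on small sets, and an approximation of \<open>f\<close> by such a \<open>g\<close>
  carries it over uniformly in \<open>E\<close>. The gliding hump rests on this.\<close>

lemma Lalpha_small_sets: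
  assumes f: "f \<in> Lalpha \<alpha>" and "0 < \<epsilon>"
  obtains \<delta> where "0 < \<delta>"
    "\<And>E. E \<in> sets circle_measure \<Longrightarrow> measure circle_measure E \<le> \<delta> \<Longrightarrow>
      ext_norm \<alpha> (\<lambda>z. indicator E z * f z) \<le> ennreal \<epsilon>"
proof -
  have "0 < \<epsilon>/2" using \<open>0 < \<epsilon>\<close> by simp
  with f obtain g where g: "g \<in> Linfty" "ext_norm \<alpha> (\<lambda>z. f z - g z) < ennreal (\<epsilon>/2)"
    unfolding Lalpha_def by blast
  obtain C where C: "0 \<le> C" "AE z in circle_measure. cmod (g z) \<le> C"
    using LinftyE[OF g(1)] by blast
  obtain \<delta> where \<delta>: "0 < \<delta>" "\<And>E. E \<in> sets circle_measure \<Longrightarrow>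
      measure circle_measure E < \<delta> \<Longrightarrow> \<alpha> (indicator E) < \<epsilon> / (2 * (C + 1))"
    using \<alpha>_indicator_small[of "\<epsilon> / (2 * (C + 1))"] C \<open>0 < \<epsilon>\<close> by auto
  have fm: "f \<in> borel_measurable circle_measure"
    using f Lalpha_subset_calL by (auto intro: calL_measurable)
  note [measurable] = fm Linfty_measurable[OF g(1)]
  show ?thesis
  proof (rule that)
    \<comment> \<open>Halving passes from the strict bound in
      \<open>\<alpha>_indicator_small\<close> to the non-strict one claimed here.\<close>
    show "0 < \<delta> / 2" using \<delta> by simp
  next
    fix E assume E: "E \<in> sets circle_measure" and mE: "measure circle_measure E \<le> \<delta> / 2"
    note [measurable] = E
    have "ext_norm \<alpha> (\<lambda>z. indicator E z * f z)
      = ext_norm \<alpha> (\<lambda>z. indicator E z * (f z - g z) + indicator E z * g z)"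
      by (simp add: algebra_simps)
    also have "\<dots> \<le> ext_norm \<alpha> (\<lambda>z. indicator E z * (f z - g z)) + ext_norm \<alpha> (\<lambda>z. indicator E z * g z)"
      by (rule ext_norm_add) measurable
    also have "\<dots> \<le> ext_norm \<alpha> (\<lambda>z. f z - g z) + ext_norm \<alpha> (\<lambda>z. of_real C * indicator E z)"
      using C by (intro add_mono ext_norm_mono) (auto simp: indicator_def)
    also have "ext_norm \<alpha> (\<lambda>z. of_real C * indicator E z) = ennreal (C * \<alpha> (indicator E))"
      using C \<alpha>_cmult[OF Linfty_indicator[OF E], of "of_real C"]
      by (simp add: ext_norm_Linfty Linfty_cmult Linfty_indicator[OF E])
    also have "\<dots> \<le> ennreal (\<epsilon>/2)"
    proof (rule ennreal_leI)
      have "C * \<alpha> (indicator E) \<le> C * (\<epsilon> / (2 * (C + 1)))"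
        using \<delta>(2)[OF E] mE \<delta>(1) C by (intro mult_left_mono) auto
      also have "\<dots> \<le> \<epsilon> / 2"
        using C \<open>0 < \<epsilon>\<close> by (simp add: field_simps)
      finally show "C * \<alpha> (indicator E) \<le> \<epsilon>/2" .
    qed
    also have "ext_norm \<alpha> (\<lambda>z. f z - g z) + ennreal (\<epsilon>/2) \<le> ennreal (\<epsilon>/2) + ennreal (\<epsilon>/2)"
      using g by (intro add_mono) auto
    also have "\<dots> = ennreal \<epsilon>"
      using \<open>0 < \<epsilon>\<close> by (simp flip: ennreal_plus)
    finally show "ext_norm \<alpha> (\<lambda>z. indicator E z * f z) \<le> ennreal \<epsilon>"
      by (simp add: add_left_mono)
  qed
qed

end

section \<open>Comparison with the \<open>L\<^sup>1\<close>-norm\<close>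

text \<open>
  Greedy choice: the mean over \<open>w\<close> of the inner product of \<open>z \<mapsto> f (cnj w * z) - c\<close> with a fixed
  function vanishes, so the next rotation can be chosen without increasing the cross term.
\<close>

lemma rotation_average:
  fixes f :: "complex \<Rightarrow> real"
  assumes f: "f \<in> borel_measurable circle_measure" and B: "\<And>z. \<bar>f z\<bar> \<le> B"
  defines "c \<equiv> integral\<^sup>L circle_measure f"
  shows "\<exists>w. (\<forall>k. w k \<in> sphere 0 1) \<and>
    (\<integral>z. (\<Sum>k<N. f (cnj (w k) * z) - c)\<^sup>2 \<partial>circle_measure) \<le> real N * (2 * B)\<^sup>2"
proof (induction N)
  case 0
  show ?case by (intro exI[of _ "\<lambda>k. 1"]) simp
next
  case (Suc N)
  then obtain w where w: "\<And>k. w k \<in> sphere 0 1"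
    and le: "(\<integral>z. (\<Sum>k<N. f (cnj (w k) * z) - c)\<^sup>2 \<partial>circle_measure) \<le> real N * (2 * B)\<^sup>2"
    by blast
  define S where "S z = (\<Sum>k<N. f (cnj (w k) * z) - c)" for z
  define g where "g v z = f (cnj v * z) - c" for v z
  note [measurable] = f
  have B0: "0 \<le> B" using B[of 0] by linarith
  have cB: "\<bar>c\<bar> \<le> B"
  proof -
    have "norm c \<le> (\<integral>z. norm (f z) \<partial>circle_measure)" unfolding c_def by simp
    also have "\<dots> \<le> (\<integral>z. B \<partial>circle_measure)"
      by (intro integral_mono circle.integrable_const_bound[of _ B]) (use B B0 f in auto)
    finally show ?thesis by (simp add: circle.prob_space[simplified])
  qed
  have gB: "\<bar>g v z\<bar> \<le> 2 * B" for v z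
    using B[of "cnj v * z"] cB unfolding g_def by linarith
  have SB: "\<bar>S z\<bar> \<le> real N * (2 * B)" for z
  proof -
    have "\<bar>S z\<bar> \<le> (\<Sum>k<N. \<bar>g (w k) z\<bar>)" unfolding S_def g_def by (rule sum_abs)
    also have "\<dots> \<le> (\<Sum>k<N. 2 * B)" by (intro sum_mono gB)
    finally show ?thesis by simp
  qed
  have gB2: "(g v z)\<^sup>2 \<le> (2 * B)\<^sup>2" and SB2: "(S z)\<^sup>2 \<le> (real N * (2 * B))\<^sup>2" for v z
    by (subst power2_le_iff_abs_le; use gB SB B0 in simp)+
  have gSB: "\<bar>g v z * S z\<bar> \<le> (2 * B) * (real N * (2 * B))" for v z
    unfolding abs_mult by (intro mult_mono gB SB) (use B0 in auto)
  have gm: "g v \<in> borel_measurable circle_measure" if "v \<in> sphere 0 1" for v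
    using measurable_compose[OF measurable_rotate[OF that] f] unfolding g_def by measurable
  have Sm: "S \<in> borel_measurable circle_measure"
    unfolding S_def using measurable_compose[OF measurable_rotate[OF w] f] by measurable
  \<comment> \<open>Fubini over rotation and point requires joint measurability, not just
    measurability in each variable.\<close>
  have pm: "(\<lambda>(v, z). cnj v * z) \<in> measurable (circle_measure \<Otimes>\<^sub>M circle_measure) circle_measure"
  proof -
    have id: "(\<lambda>z. z) \<in> borel_measurable circle_measure"
      using measurable_restrict_space1[of "\<lambda>z. z" borel borel "sphere 0 1"]
      by (simp add: measurable_cong_sets[OF sets_circle refl])
    have "(\<lambda>p. cnj (fst p) * snd p) \<in> borel_measurable (circle_measure \<Otimes>\<^sub>M circle_measure)"
    proof (rule borel_measurable_times)
      have "(\<lambda>p. cnj (id (fst p))) \<in> borel_measurable (circle_measure \<Otimes>\<^sub>M circle_measure)"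
        unfolding id_def
        by (rule measurable_compose[OF measurable_compose[OF measurable_fst id]
              borel_measurable_continuous_onI]) (intro continuous_intros)
      then show "(\<lambda>p. cnj (fst p)) \<in> borel_measurable (circle_measure \<Otimes>\<^sub>M circle_measure)" by simp
      show "snd \<in> borel_measurable (circle_measure \<Otimes>\<^sub>M circle_measure)"
        by (rule measurable_compose[OF measurable_snd id])
    qed
    then have "(\<lambda>p. cnj (fst p) * snd p) \<in> measurable (circle_measure \<Otimes>\<^sub>M circle_measure)
        (restrict_space borel (sphere 0 1))"
      by (rule measurable_restrict_space2[rotated]) (auto simp: space_pair_measure norm_mult)
    then show ?thesis
      by (simp add: measurable_cong_sets[OF refl sets_circle] case_prod_beta)
  qed
  interpret pair_sigma_finite circle_measure circle_measure ..
  interpret P: pair_prob_space circle_measure circle_measure ..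
  have fp: "(\<lambda>(v, z). f (cnj v * z)) \<in> borel_measurable (circle_measure \<Otimes>\<^sub>M circle_measure)"
    using measurable_compose[OF pm f] by (simp add: case_prod_beta)
  have gS: "(\<lambda>(v, z). g v z * S z) \<in> borel_measurable (circle_measure \<Otimes>\<^sub>M circle_measure)"
    using fp measurable_compose[OF measurable_snd Sm] unfolding g_def case_prod_beta by measurable
  have "(\<integral>v. (\<integral>z. g v z * S z \<partial>circle_measure) \<partial>circle_measure)
      = (\<integral>z. (\<integral>v. g v z * S z \<partial>circle_measure) \<partial>circle_measure)"
  proof (rule Fubini_integral[symmetric, of "\<lambda>v z. g v z * S z"])
    show "integrable (circle_measure \<Otimes>\<^sub>M circle_measure) (\<lambda>(v, z). g v z * S z)"
      by (rule P.integrable_const_bound[OF _ gS, of "(2 * B) * (real N * (2 * B))"])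
         (use gSB in \<open>simp only: case_prod_beta real_norm_def AE_I2\<close>)
  qed
  \<comment> \<open>For fixed \<open>z\<close> the mean of \<open>f (cnj v * z)\<close> over
    \<open>v\<close> is \<open>c\<close>, because \<open>v \<mapsto> cnj v * z\<close> preserves arc
    length.\<close>
  also have "\<dots> = (\<integral>z. 0 \<partial>circle_measure)"
  proof (rule Bochner_Integration.integral_cong)
    fix z :: complex assume "z \<in> space circle_measure"
    then have z: "z \<in> sphere 0 1" by simp
    have "(\<integral>v. g v z \<partial>circle_measure) = (\<integral>v. f (cnj v * z) \<partial>circle_measure) - c"
      unfolding g_def using measurable_compose[OF measurable_reflect[OF z] f] B
      by (subst Bochner_Integration.integral_diff)
         (auto intro!: circle.integrable_const_bound[of _ B] simp: circle.prob_space[simplified])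
    then show "(\<integral>v. g v z * S z \<partial>circle_measure) = 0"
      using integral_circle_reflect[OF f B z] by (simp add: c_def)
  qed simp
  finally have "(\<integral>v. (\<integral>z. g v z * S z \<partial>circle_measure) \<partial>circle_measure) = 0" by simp
  then obtain v where v: "v \<in> sphere 0 1" "(\<integral>z. g v z * S z \<partial>circle_measure) \<le> 0"
  proof (rule_tac ccontr)
    assume 0: "(\<integral>v. (\<integral>z. g v z * S z \<partial>circle_measure) \<partial>circle_measure) = 0"
      and "\<not> thesis"
    then have pos: "\<And>v. v \<in> space circle_measure \<Longrightarrow> 0 < (\<integral>z. g v z * S z \<partial>circle_measure)"
      using that by force
    have "integrable circle_measure (\<lambda>v. \<integral>z. g v z * S z \<partial>circle_measure)"
      by (rule integrable_fst[of "\<lambda>v z. g v z * S z"],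
          rule P.integrable_const_bound[OF _ gS, of "(2 * B) * (real N * (2 * B))"])
         (use gSB in \<open>simp only: case_prod_beta real_norm_def AE_I2\<close>)
    from circle.expectation_greater[of _ 0, OF this AE_I2[OF pos]] 0
    show False by simp
  qed
  define w' where "w' = w(N := v)"
  have "(\<Sum>k<Suc N. f (cnj (w' k) * z) - c) = S z + g v z" for z
    by (simp add: w'_def S_def g_def)
  then have "(\<integral>z. (\<Sum>k<Suc N. f (cnj (w' k) * z) - c)\<^sup>2 \<partial>circle_measure)
    = (\<integral>z. (S z)\<^sup>2 + (2 * (g v z * S z) + (g v z)\<^sup>2) \<partial>circle_measure)"
    by (simp add: power2_eq_square algebra_simps)
  also have "\<dots> = (\<integral>z. (S z)\<^sup>2 \<partial>circle_measure)
      + (2 * (\<integral>z. g v z * S z \<partial>circle_measure) + (\<integral>z. (g v z)\<^sup>2 \<partial>circle_measure))"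
  proof -
    have i1: "integrable circle_measure (\<lambda>z. (S z)\<^sup>2)"
      by (rule circle.integrable_const_bound[of _ "(real N * (2 * B))\<^sup>2"])
         (use SB2 Sm in auto)
    have i2: "integrable circle_measure (\<lambda>z. (g v z)\<^sup>2)"
      by (rule circle.integrable_const_bound[of _ "(2 * B)\<^sup>2"])
         (use gB2 gm[OF v(1)] in auto)
    have i3: "integrable circle_measure (\<lambda>z. g v z * S z)"
      by (rule circle.integrable_const_bound[of _ "(2 * B) * (real N * (2 * B))"])
         (use gSB gm[OF v(1)] Sm in \<open>auto simp del: abs_mult\<close>)
    show ?thesis using i1 i2 i3 by simp
  qed
  \<comment> \<open>With a nonpositive cross term each rotation adds at most
    \<open>(2 * B)\<^sup>2\<close>. Linear growth in \<open>N\<close> is the point: division by the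
    square of \<open>N\<close> sends the variance of the average to 0.\<close>
  also have "\<dots> \<le> real N * (2 * B)\<^sup>2 + (0 + (2 * B)\<^sup>2)"
  proof (intro add_mono)
    have "(\<integral>z. (g v z)\<^sup>2 \<partial>circle_measure) \<le> (\<integral>z. (2 * B)\<^sup>2 \<partial>circle_measure)"
      by (intro integral_mono circle.integrable_const_bound[of _ "(2 * B)\<^sup>2"])
         (use gB2 gm[OF v(1)] in auto)
    then show "(\<integral>z. (g v z)\<^sup>2 \<partial>circle_measure) \<le> (2 * B)\<^sup>2"
      by (simp add: circle.prob_space[simplified])
  qed (use le v in \<open>auto simp: S_def\<close>)
  also have "\<dots> = real (Suc N) * (2 * B)\<^sup>2" by (simp add: algebra_simps)
  finally show ?case
    using w v by (intro exI[of _ w']) (auto simp: w'_def)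
qed

context Rc_norm
begin

lemma \<alpha>_sum:
  "finite I \<Longrightarrow> (\<And>i. i \<in> I \<Longrightarrow> f i \<in> Linfty) \<Longrightarrow> \<alpha> (\<lambda>z. \<Sum>i\<in>I. f i z) \<le> (\<Sum>i\<in>I. \<alpha> (f i))"
proof (induction I rule: finite_induct)
  case empty
  then show ?case using \<alpha>_const[of 0] by simp
next
  case (insert i I)
  then have "\<alpha> (\<lambda>z. f i z + (\<Sum>i\<in>I. f i z)) \<le> \<alpha> (f i) + \<alpha> (\<lambda>z. \<Sum>i\<in>I. f i z)"
    by (intro \<alpha>_add Linfty_sum) auto
  then show ?case using insert by force
qed

text \<open>An average of rotates of \<open>f\<close> has seminorm at most that of \<open>f\<close>.
  By \<open>rotation_average\<close> some averages are close in measure to the constant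
  \<open>c\<close>, within a fixed bound, so \<open>\<alpha>_small\<close> makes the error
  \<open>h\<close> negligible, and the seminorm of the constant is \<open>|c|\<close>.\<close>

lemma integral_le_\<alpha>:
  fixes f :: "complex \<Rightarrow> real"
  assumes f: "f \<in> borel_measurable circle_measure" and B: "\<And>z. \<bar>f z\<bar> \<le> B"
  shows "\<bar>integral\<^sup>L circle_measure f\<bar> \<le> \<alpha> (\<lambda>z. of_real (f z))"
proof (rule field_le_epsilon)
  fix \<epsilon> :: real assume \<epsilon>: "0 < \<epsilon>"
  define c where "c = integral\<^sup>L circle_measure f"
  have B0: "0 \<le> B" using B[of 0] by linarith
  have cB: "\<bar>c\<bar> \<le> B"
  proof -
    have "norm c \<le> (\<integral>z. norm (f z) \<partial>circle_measure)" unfolding c_def by simp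
    also have "\<dots> \<le> (\<integral>z. B \<partial>circle_measure)"
      by (intro integral_mono circle.integrable_const_bound[of _ B]) (use B B0 f in auto)
    finally show ?thesis by (simp add: circle.prob_space[simplified])
  qed
  obtain \<delta> where \<delta>: "0 < \<delta>"
    "\<And>h. h \<in> Linfty \<Longrightarrow> (AE z in circle_measure. cmod (h z) \<le> 2 * B) \<Longrightarrow>
       measure circle_measure {z \<in> space circle_measure. cmod (h z) > \<delta>} < \<delta> \<Longrightarrow> \<alpha> h < \<epsilon>"
    using \<alpha>_small[OF \<epsilon>, of "2 * B"] B0 by auto
  \<comment> \<open>Chebyshev's inequality bounds the measure of the set where
    \<open>|h| \<ge> \<delta>\<close> by \<open>(2 * B)\<^sup>2 / (N * \<delta>\<^sup>2)\<close>,
    and this \<open>N\<close> makes the bound less than \<open>\<delta>\<close>.\<close>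
  obtain N :: nat where N: "(2 * B)\<^sup>2 / (\<delta>\<^sup>2 * \<delta>) < real N"
    using reals_Archimedean2 by blast
  moreover have "0 \<le> (2 * B)\<^sup>2 / (\<delta>\<^sup>2 * \<delta>)" using \<delta>(1) by simp
  ultimately have N0: "0 < real N" by linarith
  obtain w where w: "\<And>k. w k \<in> sphere 0 1"
    and le: "(\<integral>z. (\<Sum>k<N. f (cnj (w k) * z) - c)\<^sup>2 \<partial>circle_measure) \<le> real N * (2 * B)\<^sup>2"
    using rotation_average[OF f B, of N] unfolding c_def by blast
  define F where "F z = complex_of_real (f z)" for z
  have FL: "F \<in> Linfty"
    unfolding F_def using f B by (intro LinftyI[of _ B]) auto
  have rm: "(\<lambda>z. f (cnj (w k) * z)) \<in> borel_measurable circle_measure" for k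
    using measurable_compose[OF measurable_rotate[OF w] f] .
  have RL: "rotate_fun (w k) F \<in> Linfty" for k
    unfolding F_def rotate_fun_def using rm B by (intro LinftyI[of _ B]) auto
  define h where "h z = (c - (\<Sum>k<N. f (cnj (w k) * z)) / real N)" for z
  have h_eq: "h z = - (\<Sum>k<N. f (cnj (w k) * z) - c) / real N" for z
    using N0 by (simp add: h_def sum_subtractf field_simps)
  have hm: "h \<in> borel_measurable circle_measure"
    unfolding h_def using rm by measurable
  have hB: "\<bar>h z\<bar> \<le> 2 * B" for z
  proof -
    have "\<bar>\<Sum>k<N. f (cnj (w k) * z)\<bar> \<le> (\<Sum>k<N. B)"
      by (rule order_trans[OF sum_abs sum_mono]) (rule B)
    then have "\<bar>(\<Sum>k<N. f (cnj (w k) * z)) / real N\<bar> \<le> B"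
      using N0 by (simp add: abs_divide field_simps)
    then show ?thesis using cB unfolding h_def by linarith
  qed
  have hB2: "(h z)\<^sup>2 \<le> (2 * B)\<^sup>2" for z
    by (subst power2_le_iff_abs_le; use hB B0 in simp)
  have hL: "(\<lambda>z. complex_of_real (h z)) \<in> Linfty"
    using hm hB by (intro LinftyI[of _ "2 * B"]) auto
  have "\<alpha> (\<lambda>z. complex_of_real (h z)) < \<epsilon>"
  proof (rule \<delta>(2)[OF hL])
    show "AE z in circle_measure. cmod (complex_of_real (h z)) \<le> 2 * B"
      using hB by simp
    have "integrable circle_measure (\<lambda>z. (h z)\<^sup>2)"
      by (rule circle.integrable_const_bound[of _ "(2 * B)\<^sup>2"])
         (use hm hB2 in auto)
    then have "measure circle_measure {z \<in> space circle_measure. (h z)\<^sup>2 \<ge> \<delta>\<^sup>2} \<le> (\<integral>z. (h z)\<^sup>2 \<partial>circle_measure) / \<delta>\<^sup>2"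
      by (rule integral_Markov_inequality_measure[of _ _ "{}"]) (use \<delta>(1) in auto)
    also have "(\<integral>z. (h z)\<^sup>2 \<partial>circle_measure)
        = (\<integral>z. (\<Sum>k<N. f (cnj (w k) * z) - c)\<^sup>2 \<partial>circle_measure) / (real N)\<^sup>2"
      unfolding h_eq by (simp add: power_divide)
    also have "\<dots> / \<delta>\<^sup>2 \<le> (real N * (2 * B)\<^sup>2) / (real N)\<^sup>2 / \<delta>\<^sup>2"
      by (intro divide_right_mono le) auto
    also have "\<dots> = (2 * B)\<^sup>2 / \<delta>\<^sup>2 / real N"
      using N0 by (simp add: power2_eq_square)
    also have "\<dots> < \<delta>"
      using N N0 \<delta>(1) by (simp add: field_simps)
    finally have "measure circle_measure {z \<in> space circle_measure. (h z)\<^sup>2 \<ge> \<delta>\<^sup>2} < \<delta>" .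
    moreover have "measure circle_measure {z \<in> space circle_measure. cmod (complex_of_real (h z)) > \<delta>}
       \<le> measure circle_measure {z \<in> space circle_measure. (h z)\<^sup>2 \<ge> \<delta>\<^sup>2}"
    proof (rule circle.finite_measure_mono)
      show "{z \<in> space circle_measure. (h z)\<^sup>2 \<ge> \<delta>\<^sup>2} \<in> sets circle_measure"
        using hm by measurable
    qed (use \<delta>(1) in \<open>auto simp flip: abs_le_square_iff\<close>)
    ultimately show "measure circle_measure {z \<in> space circle_measure. cmod (complex_of_real (h z)) > \<delta>} < \<delta>"
      by linarith
  qed
  moreover have "\<bar>c\<bar> \<le> \<alpha> F + \<alpha> (\<lambda>z. complex_of_real (h z))"
  proof -
    let ?a = "\<lambda>z. of_real (1 / real N) * (\<Sum>k<N. rotate_fun (w k) F z)"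
    have sL: "(\<lambda>z. \<Sum>k<N. rotate_fun (w k) F z) \<in> Linfty"
      by (intro Linfty_sum RL)
    have "(\<lambda>z. complex_of_real c) = (\<lambda>z. ?a z + of_real (h z))"
      by (auto simp: h_def rotate_fun_def F_def)
    then have "\<bar>c\<bar> = \<alpha> (\<lambda>z. ?a z + of_real (h z))"
      using \<alpha>_const[of "of_real c"] by simp
    also have "\<dots> \<le> \<alpha> ?a + \<alpha> (\<lambda>z. of_real (h z))"
      by (rule \<alpha>_add[OF Linfty_cmult[OF sL] hL])
    also have "\<alpha> ?a = (1 / real N) * \<alpha> (\<lambda>z. \<Sum>k<N. rotate_fun (w k) F z)"
      using \<alpha>_cmult[OF sL, of "of_real (1 / real N)"] by (simp add: norm_divide)
    also have "\<dots> \<le> (1 / real N) * (\<Sum>k<N. \<alpha> (rotate_fun (w k) F))"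
      by (intro mult_left_mono \<alpha>_sum RL) auto
    also have "(\<Sum>k<N. \<alpha> (rotate_fun (w k) F)) = real N * \<alpha> F"
      using \<alpha>_rotate[OF FL w] by simp
    finally show ?thesis using N0 by simp
  qed
  ultimately show "\<bar>integral\<^sup>L circle_measure f\<bar> \<le> \<alpha> (\<lambda>z. of_real (f z)) + \<epsilon>"
    unfolding c_def F_def by linarith
qed

lemma nn_integral_le_ext_norm:
  assumes f: "f \<in> borel_measurable circle_measure"
  shows "(\<integral>\<^sup>+z. cmod (f z) \<partial>circle_measure) \<le> ext_norm \<alpha> f"
proof -
  define g where "g n z = min (cmod (f z)) (real n)" for n z
  have gm: "g n \<in> borel_measurable circle_measure" for n
    unfolding g_def using f by measurable
  have gB: "\<bar>g n z\<bar> \<le> real n" for n z by (auto simp: g_def)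
  have "(\<integral>\<^sup>+z. cmod (f z) \<partial>circle_measure) = (\<integral>\<^sup>+z. (SUP n. ennreal (g n z)) \<partial>circle_measure)"
  proof (rule nn_integral_cong)
    fix z
    obtain m where m: "cmod (f z) \<le> real m" using real_arch_simple by blast
    show "ennreal (cmod (f z)) = (SUP n. ennreal (g n z))"
    proof (rule antisym)
      show "ennreal (cmod (f z)) \<le> (SUP n. ennreal (g n z))"
        using m by (intro SUP_upper2[of m]) (auto simp: g_def)
      show "(SUP n. ennreal (g n z)) \<le> ennreal (cmod (f z))"
        by (intro SUP_least ennreal_leI) (simp add: g_def)
    qed
  qed
  also have "\<dots> = (SUP n. \<integral>\<^sup>+z. ennreal (g n z) \<partial>circle_measure)"
  proof (rule nn_integral_monotone_convergence_SUP)
    show "incseq (\<lambda>n z. ennreal (g n z))"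
      by (auto simp: incseq_def le_fun_def g_def intro!: ennreal_leI)
  qed (use gm in simp)
  also have "\<dots> \<le> ext_norm \<alpha> f"
  proof (rule SUP_least)
    fix n
    have "integrable circle_measure (g n)"
      by (rule circle.integrable_const_bound[of _ "real n"]) (use gm gB in auto)
    then have "(\<integral>\<^sup>+z. ennreal (g n z) \<partial>circle_measure) = ennreal (integral\<^sup>L circle_measure (g n))"
      by (rule nn_integral_eq_integral) (simp add: g_def)
    also have "\<dots> \<le> ennreal (\<alpha> (\<lambda>z. of_real (g n z)))"
      using integral_le_\<alpha>[OF gm gB, of n] by (intro ennreal_leI) simp
    also have "\<dots> \<le> ext_norm \<alpha> f"
      by (rule ext_norm_ge) (use f in \<open>auto simp: g_def intro!: Linfty_min\<close>)
    finally show "(\<integral>\<^sup>+z. ennreal (g n z) \<partial>circle_measure) \<le> ext_norm \<alpha> f" .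
  qed
  finally show ?thesis .
qed

lemma calL_integrable:
  assumes "f \<in> calL \<alpha>"
  shows "integrable circle_measure f"
proof (rule integrableI_bounded)
  show "f \<in> borel_measurable circle_measure" using assms by (rule calL_measurable)
  from nn_integral_le_ext_norm[OF this] show "(\<integral>\<^sup>+z. norm (f z) \<partial>circle_measure) < \<infinity>"
    using assms by (auto simp: calL_def intro: le_less_trans)
qed

lemma integral_cmod_le_ext_norm:
  assumes f: "f \<in> calL \<alpha>"
  shows "(\<integral>z. cmod (f z) \<partial>circle_measure) \<le> enn2real (ext_norm \<alpha> f)"
proof -
  have "ennreal (\<integral>z. cmod (f z) \<partial>circle_measure) = (\<integral>\<^sup>+z. cmod (f z) \<partial>circle_measure)"
    using calL_integrable[OF f] by (intro nn_integral_eq_integral[symmetric]) auto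
  also have "\<dots> \<le> ext_norm \<alpha> f"
    by (rule nn_integral_le_ext_norm[OF calL_measurable[OF f]])
  also have "\<dots> = ennreal (enn2real (ext_norm \<alpha> f))"
    using f by (simp add: calL_def)
  finally show ?thesis by simp
qed

end

section \<open>Weak sequential completeness\<close>

lemma bounded_functional_onE:
  assumes "bounded_functional_on V p \<phi>" "\<And>f. f \<in> V \<Longrightarrow> 0 \<le> p f"
  obtains C where "0 \<le> C" "\<And>f. f \<in> V \<Longrightarrow> cmod (\<phi> f) \<le> C * p f"
proof -
  obtain C where C: "\<And>f. f \<in> V \<Longrightarrow> cmod (\<phi> f) \<le> C * p f"
    using assms(1) unfolding bounded_functional_on_def by blast
  show ?thesis
  proof (rule that[of "max C 0"])
    fix f assume f: "f \<in> V"
    have "C * p f \<le> max C 0 * p f"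
      using assms(2)[OF f] by (intro mult_right_mono) auto
    then show "cmod (\<phi> f) \<le> max C 0 * p f"
      using C[OF f] by linarith
  qed simp
qed

context Rc_norm
begin

text \<open>\<open>enn2real\<close> sends infinity to 0, so \<open>lnorm\<close> agrees with
  \<open>ext_norm\<close> only where the latter is finite; on \<open>Lalpha \<alpha>\<close> this is
  \<open>ext_norm_finite\<close>.\<close>

abbreviation lnorm :: "(complex \<Rightarrow> complex) \<Rightarrow> real" where
  "lnorm f \<equiv> enn2real (ext_norm \<alpha> f)"

abbreviation dual :: "((complex \<Rightarrow> complex) \<Rightarrow> complex) \<Rightarrow> bool" where
  "dual \<phi> \<equiv> bounded_functional_on (Lalpha \<alpha>) lnorm \<phi>"

lemma ext_norm_finite: "f \<in> Lalpha \<alpha> \<Longrightarrow> ext_norm \<alpha> f < top"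
  using Lalpha_subset_calL by (auto simp: calL_def)

lemma Lalpha_measurable: "f \<in> Lalpha \<alpha> \<Longrightarrow> f \<in> borel_measurable circle_measure"
  using Lalpha_subset_calL by (auto simp: calL_def)

lemma lnorm_le:
  "ext_norm \<alpha> f \<le> ennreal K \<Longrightarrow> 0 \<le> K \<Longrightarrow> lnorm f \<le> K"
  by (metis enn2real_ennreal enn2real_mono ennreal_less_top)

sublocale seminormed_functions "Lalpha \<alpha>" lnorm
proof
  fix f g assume f: "f \<in> Lalpha \<alpha>" and g: "g \<in> Lalpha \<alpha>"
  have "lnorm (\<lambda>z. f z + g z) \<le> enn2real (ext_norm \<alpha> f + ext_norm \<alpha> g)"
    using ext_norm_finite[OF f] ext_norm_finite[OF g]
    by (intro enn2real_mono ext_norm_add Lalpha_measurable f g) auto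
  also have "\<dots> = lnorm f + lnorm g"
    by (rule enn2real_plus[OF ext_norm_finite[OF f] ext_norm_finite[OF g]])
  finally show "lnorm (\<lambda>z. f z + g z) \<le> lnorm f + lnorm g" .
qed (simp_all add: Lalpha_add Lalpha_cmult ext_norm_cmult enn2real_mult)

section \<open>Bounded functionals on \<open>Lalpha\<close> and the action of bounded
  multipliers\<close>

lemma dual_add: "dual \<phi> \<Longrightarrow> f \<in> Lalpha \<alpha> \<Longrightarrow> g \<in> Lalpha \<alpha> \<Longrightarrow> \<phi> (\<lambda>z. f z + g z) = \<phi> f + \<phi> g"
  by (simp add: bounded_functional_on_def)

lemma dual_cmult: "dual \<phi> \<Longrightarrow> f \<in> Lalpha \<alpha> \<Longrightarrow> \<phi> (\<lambda>z. c * f z) = c * \<phi> f"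
  by (simp add: bounded_functional_on_def)

lemma dual_diff:
  assumes "dual \<phi>" "f \<in> Lalpha \<alpha>" "g \<in> Lalpha \<alpha>"
  shows "\<phi> (\<lambda>z. f z - g z) = \<phi> f - \<phi> g"
  using dual_add[OF assms(1,2) Lalpha_cmult[OF assms(3), of "-1"]] dual_cmult[OF assms(1,3), of "-1"]
  by simp

lemma dual_sum:
  assumes \<phi>: "dual \<phi>" and f: "\<And>i. i \<in> I \<Longrightarrow> f i \<in> Linfty"
  shows "\<phi> (\<lambda>z. \<Sum>i\<in>I. c i * f i z) = (\<Sum>i\<in>I. c i * \<phi> (f i))"
  using f
proof (induction I rule: infinite_finite_induct)
  case (insert i I)
  have "\<phi> (\<lambda>z. c i * f i z + (\<Sum>i\<in>I. c i * f i z)) = \<phi> (\<lambda>z. c i * f i z) + \<phi> (\<lambda>z. \<Sum>i\<in>I. c i * f i z)"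
    using insert.prems Linfty_subset_Lalpha
    by (intro dual_add[OF \<phi>] subsetD[OF Linfty_subset_Lalpha] Linfty_cmult Linfty_sum) auto
  then show ?case
    using insert subsetD[OF Linfty_subset_Lalpha] by (simp add: dual_cmult[OF \<phi>])
qed (use dual_cmult[OF \<phi> subsetD[OF Linfty_subset_Lalpha Linfty_const[of 0]], of 0] in simp_all)

text \<open>Multiplication by \<open>u\<close> is a contraction of \<open>Lalpha\<close>, so
  composing with it keeps a functional bounded. The gliding hump takes an indicator for
  \<open>u\<close>.\<close>

lemma dual_mult:
  assumes \<phi>: "dual \<phi>" and u: "u \<in> Linfty" "\<And>z. cmod (u z) \<le> 1"
  shows "dual (\<lambda>f. \<phi> (\<lambda>z. u z * f z))"
proof -
  obtain C where C: "0 \<le> C" "\<And>f. f \<in> Lalpha \<alpha> \<Longrightarrow> cmod (\<phi> f) \<le> C * lnorm f"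
    using bounded_functional_onE[OF \<phi>] by (metis enn2real_nonneg)
  have "cmod (\<phi> (\<lambda>z. u z * f z)) \<le> C * lnorm f" if f: "f \<in> Lalpha \<alpha>" for f
  proof -
    have "lnorm (\<lambda>z. u z * f z) \<le> lnorm f"
      using ext_norm_finite[OF f]
      by (intro enn2real_mono ext_norm_mono) (auto simp: norm_mult u mult_left_le_one_le)
    then show ?thesis
      using C(2)[OF Lalpha_mult[OF f u(1)]] C(1) by (meson mult_left_mono order_trans)
  qed
  moreover have "\<phi> (\<lambda>z. u z * (c * f z)) = c * \<phi> (\<lambda>z. u z * f z)" if "f \<in> Lalpha \<alpha>" for f c
    using dual_cmult[OF \<phi> Lalpha_mult[OF that u(1)], of c] by (simp add: mult.left_commute)
  ultimately show ?thesis
    using dual_add[OF \<phi> Lalpha_mult[OF _ u(1)] Lalpha_mult[OF _ u(1)]]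
    unfolding bounded_functional_on_def by (auto simp: distrib_left)
qed

text \<open>Boundedness is the domination of the \<open>L^1\<close>-norm by \<alpha>. These
  functionals identify a weak limit, since \<open>u\<close> may be chosen to fit the function that
  should vanish.\<close>

lemma dual_integral:
  assumes u: "u \<in> Linfty" "\<And>z. cmod (u z) \<le> 1"
  shows "dual (\<lambda>f. \<integral>z. u z * f z \<partial>circle_measure)"
proof -
  have int: "integrable circle_measure (\<lambda>z. u z * f z)" if f: "f \<in> Lalpha \<alpha>" for f
    using Lalpha_mult[OF f u(1)] Lalpha_subset_calL by (auto intro: calL_integrable)
  have "cmod (\<integral>z. u z * f z \<partial>circle_measure) \<le> 1 * lnorm f" if f: "f \<in> Lalpha \<alpha>" for f
  proof -
    have fc: "f \<in> calL \<alpha>" using f Lalpha_subset_calL by auto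
    have "cmod (\<integral>z. u z * f z \<partial>circle_measure) \<le> (\<integral>z. cmod (u z * f z) \<partial>circle_measure)"
      by (rule integral_norm_bound)
    also have "\<dots> \<le> (\<integral>z. cmod (f z) \<partial>circle_measure)"
      by (rule integral_mono[OF integrable_norm[OF int[OF f]] integrable_norm[OF calL_integrable[OF fc]]])
         (simp add: norm_mult u mult_left_le_one_le)
    also have "\<dots> \<le> lnorm f" by (rule integral_cmod_le_ext_norm[OF fc])
    finally show ?thesis by simp
  qed
  then show ?thesis
    using int unfolding bounded_functional_on_def
    by (auto simp: distrib_left mult.left_commute[of "u _"] intro: exI[of _ 1])
qed

text \<open>
  Gliding hump: a subsequence is, up to small errors, supported on disjoint sets \<open>A j - U j\<close>.
  Multiplying by the indicator \<open>W\<close> of every second of these sets yields a functional along which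
  the sequence would oscillate if the limit of \<open>\<phi> (H k)\<close> were not zero.
\<close>

lemma weakly_convergent_AE_null_imp_null:
  assumes H: "\<And>k. H k \<in> Lalpha \<alpha>" and lim: "AE z in circle_measure. (\<lambda>k. H k z) \<longlonglongrightarrow> 0"
    and conv: "\<And>\<phi>. dual \<phi> \<Longrightarrow> convergent (\<lambda>k. \<phi> (H k))"
    and \<phi>: "dual \<phi>"
  shows "(\<lambda>k. \<phi> (H k)) \<longlonglongrightarrow> 0"
proof -
  have Hm [measurable]: "H k \<in> borel_measurable circle_measure" for k
    by (rule Lalpha_measurable[OF H])
  \<comment> \<open>A state is an index together with a measure budget. \<open>P\<close> says that
    sets within the budget carry norm at most \<open>2 ^ - j\<close> of the chosen function;
    \<open>Q\<close> says that the next function is large only on a set of half the budget, and that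
    the budget at least halves.\<close>
  define P where "P j s \<longleftrightarrow> 0 < snd s \<and> (\<forall>E\<in>sets circle_measure. measure circle_measure E \<le> snd s \<longrightarrow>
     ext_norm \<alpha> (\<lambda>z. indicator E z * H (fst s) z) \<le> ennreal ((1/2) ^ j))" for j :: nat and s :: "nat \<times> real"
  define Q where "Q j s s' \<longleftrightarrow> fst s < fst s' \<and> snd s' \<le> snd s / 2 \<and>
     measure circle_measure {z \<in> space circle_measure. cmod (H (fst s') z) > (1/2) ^ Suc j} \<le> snd s / 2"
    for j :: nat and s s' :: "nat \<times> real"
  have ex_small: "\<exists>\<delta>>0. \<forall>E\<in>sets circle_measure. measure circle_measure E \<le> \<delta> \<longrightarrow>
      ext_norm \<alpha> (\<lambda>z. indicator E z * H k z) \<le> ennreal ((1/2) ^ j)" for k j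
    using Lalpha_small_sets[OF H[of k], of "(1/2) ^ j"] by (metis zero_less_divide_1_iff zero_less_numeral zero_less_power)
  have "\<exists>s. \<forall>j. P j (s j) \<and> Q j (s j) (s (Suc j))"
  proof (rule dependent_nat_choice)
    show "\<exists>s. P 0 s" using ex_small[of 0 0] by (auto simp: P_def)
  next
    fix s j assume "P j s"
    then have s: "0 < snd s / 2" by (simp add: P_def)
    have "(\<lambda>k. measure circle_measure {z \<in> space circle_measure. cmod (H k z) > (1/2) ^ Suc j}) \<longlonglongrightarrow> 0"
      by (rule measure_circle_tendsto_0[OF Hm lim]) simp
    then have "eventually (\<lambda>k. measure circle_measure {z \<in> space circle_measure. cmod (H k z) > (1/2) ^ Suc j}
       < snd s / 2 \<and> fst s < k) sequentially"
      by (intro eventually_conj order_tendstoD(2)[OF _ s] eventually_gt_at_top)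
    then obtain k where k: "fst s < k"
      "measure circle_measure {z \<in> space circle_measure. cmod (H k z) > (1/2) ^ Suc j} < snd s / 2"
      by (auto simp: eventually_sequentially)
    obtain \<delta> where \<delta>: "0 < \<delta>" "\<And>E. E \<in> sets circle_measure \<Longrightarrow> measure circle_measure E \<le> \<delta> \<Longrightarrow>
      ext_norm \<alpha> (\<lambda>z. indicator E z * H k z) \<le> ennreal ((1/2) ^ Suc j)"
      using ex_small[of k "Suc j"] by blast
    have "P (Suc j) (k, min \<delta> (snd s / 2))"
      using \<delta> s unfolding P_def fst_conv snd_conv by auto
    moreover have "Q j s (k, min \<delta> (snd s / 2))"
      using k unfolding Q_def fst_conv snd_conv by auto
    ultimately show "\<exists>s'. P (Suc j) s' \<and> Q j s s'" by blast
  qed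
  then obtain s where s: "\<And>j. P j (s j)" "\<And>j. Q j (s j) (s (Suc j))" by blast
  define k where "k j = fst (s j)" for j
  define d where "d j = snd (s j)" for j
  define A where "A j = {z \<in> space circle_measure. cmod (H (k j) z) > (1/2) ^ j}" for j
  have d: "0 < d j" "d (Suc j) \<le> d j / 2" for j
    using s(1)[of j] s(2)[of j] by (simp_all add: P_def Q_def d_def)
  have d_small: "ext_norm \<alpha> (\<lambda>z. indicator E z * H (k j) z) \<le> ennreal ((1/2) ^ j)"
    if "E \<in> sets circle_measure" "measure circle_measure E \<le> d j" for E j
    using s(1)[of j] that by (simp add: P_def d_def k_def)
  have A_le: "measure circle_measure (A (Suc j)) \<le> d j / 2" for j
    using s(2)[of j] unfolding Q_def A_def d_def k_def by blast
  have k_mono: "strict_mono k"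
    using s(2) by (simp add: strict_mono_Suc_iff k_def Q_def)
  have Am [measurable]: "A j \<in> sets circle_measure" for j
    unfolding A_def by measurable
  define U where "U j = (\<Union>i. A (Suc (j + i)))" for j
  have Um [measurable]: "U j \<in> sets circle_measure" for j
    unfolding U_def by measurable
  have d_geo: "d (j + i) \<le> (1/2) ^ i * d j" for i j
  proof (induction i)
    case (Suc i)
    then show ?case using d(2)[of "j + i"] by simp
  qed simp
  have A_geo: "measure circle_measure (A (Suc (j + i))) \<le> (1/2) ^ i * (d j / 2)" for i j
    using A_le[of "j + i"] d_geo[of j i] by simp
  have geo: "(\<lambda>i. (1/2) ^ i * (d j / 2)) sums d j" for j
    using sums_mult2[OF geometric_sums[of "1/2 :: real"], of "d j / 2"] by simp
  \<comment> \<open>The later sets have measure at most \<open>d j / 2\<close>,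
    \<open>d j / 4\<close> and so on, in total at most \<open>d j\<close>; thus \<open>U j\<close>
    stays within the budget of \<open>d_small\<close>.\<close>
  have U_le: "measure circle_measure (U j) \<le> d j" for j
  proof -
    have summ: "summable (\<lambda>i. measure circle_measure (A (Suc (j + i))))"
      by (rule summable_comparison_test'[OF sums_summable[OF geo[of j]], of 0]) (use A_geo in simp)
    have "measure circle_measure (U j) \<le> (\<Sum>i. measure circle_measure (A (Suc (j + i))))"
      unfolding U_def by (rule circle.finite_measure_subadditive_countably[OF _ summ]) auto
    also have "\<dots> \<le> (\<Sum>i. (1/2) ^ i * (d j / 2))"
      by (rule suminf_le[OF A_geo summ sums_summable[OF geo]])
    also have "\<dots> = d j" by (rule sums_unique[OF geo, symmetric])
    finally show ?thesis .
  qed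
  have A_U: "A i \<subseteq> U j" if "j < i" for i j
    unfolding U_def using that less_imp_Suc_add[of j i] by (auto simp: image_iff)
  define W where "W = (\<Union>j\<in>{j. even j}. A j - U j)"
  have Wm: "W \<in> sets circle_measure" unfolding W_def by measurable
  define w :: "complex \<Rightarrow> complex" where "w = indicator W"
  have wL: "w \<in> Linfty" unfolding w_def by (rule Linfty_indicator[OF Wm])
  define e :: "nat \<Rightarrow> complex" where "e j = (if even j then 1 else 0)" for j
  \<comment> \<open>Off \<open>A j\<close> the function is small and \<open>U j\<close> is kept on
    the right, so only \<open>A j - U j\<close> matters. Those sets are pairwise disjoint, as
    \<open>A i\<close> lies in \<open>U j\<close> for every \<open>j < i\<close>; hence on
    \<open>A j - U j\<close> the value of \<open>w\<close> is 1 for even \<open>j\<close> and 0 for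
    odd \<open>j\<close>.\<close>
  have key: "cmod ((w z - e j) * H (k j) z) \<le> cmod (indicator (U j) z * H (k j) z) + (1/2) ^ j"
    if z: "z \<in> space circle_measure" for z j
  proof (cases "w z = e j \<or> z \<in> U j \<or> z \<notin> A j")
    case True
    have "cmod (w z - e j) \<le> 1" by (auto simp: w_def e_def indicator_def)
    then have "cmod ((w z - e j) * H (k j) z) \<le> cmod (H (k j) z)"
      by (simp add: norm_mult mult_left_le_one_le)
    moreover have "cmod (H (k j) z) \<le> (1/2) ^ j" if "z \<notin> A j"
      using that z by (simp add: A_def)
    ultimately show ?thesis using True by (auto simp: indicator_def norm_mult intro: add_increasing2)
  next
    case False
    show ?thesis
    proof (cases "even j")
      case True
      then have "z \<in> W" using False by (auto simp: W_def)
      then show ?thesis using False True by (simp add: w_def e_def)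
    next
      case odd: False
      then have "z \<in> W" using False by (auto simp: w_def e_def indicator_def split: if_splits)
      then obtain i where i: "even i" "z \<in> A i" "z \<notin> U i" by (auto simp: W_def)
      then have "i \<noteq> j" using odd by auto
      then have "z \<in> U j \<or> z \<notin> A j" using i A_U[of i j] A_U[of j i] by (meson nat_neq_iff subsetD)
      then show ?thesis using False by simp
    qed
  qed
  have wH: "lnorm (\<lambda>z. (w z - e j) * H (k j) z) \<le> 2 * (1/2) ^ j" for j
  proof (rule lnorm_le)
    let ?f = "\<lambda>z. complex_of_real (cmod (indicator (U j) z * H (k j) z))"
    let ?c = "complex_of_real ((1/2) ^ j)"
    have "ext_norm \<alpha> (\<lambda>z. (w z - e j) * H (k j) z) \<le> ext_norm \<alpha> (\<lambda>z. ?f z + ?c)"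
    proof (rule ext_norm_mono[OF AE_I2])
      fix z assume "z \<in> space circle_measure"
      from key[OF this, of j]
      have "cmod ((w z - e j) * H (k j) z) \<le> cmod (complex_of_real (cmod (indicator (U j) z * H (k j) z) + (1/2) ^ j))"
        unfolding norm_of_real by linarith
      then show "cmod ((w z - e j) * H (k j) z) \<le> cmod (?f z + ?c)" by (simp only: of_real_add)
    qed
    also have "\<dots> \<le> ext_norm \<alpha> ?f + ext_norm \<alpha> (\<lambda>z. ?c)"
      by (rule ext_norm_add) measurable
    also have "ext_norm \<alpha> ?f = ext_norm \<alpha> (\<lambda>z. indicator (U j) z * H (k j) z)"
      by (rule ext_norm_cong) simp
    also have "\<dots> \<le> ennreal ((1/2) ^ j)" by (rule d_small[OF Um U_le])
    also have "ext_norm \<alpha> (\<lambda>z. ?c) = ennreal ((1/2) ^ j)"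
      using ext_norm_Linfty[OF Linfty_const[of ?c]] \<alpha>_const[of ?c] by (simp add: norm_power norm_divide)
    also have "ennreal ((1/2) ^ j) + ennreal ((1/2) ^ j) = ennreal (2 * (1/2) ^ j)"
      by (simp flip: ennreal_plus)
    finally show "ext_norm \<alpha> (\<lambda>z. (w z - e j) * H (k j) z) \<le> ennreal (2 * (1/2) ^ j)"
      by (simp add: add_right_mono)
  qed simp
  define \<psi> where "\<psi> h = \<phi> (\<lambda>z. w z * h z)" for h
  have \<psi>: "dual \<psi>"
    unfolding \<psi>_def by (rule dual_mult[OF \<phi> wL]) (auto simp: w_def indicator_def)
  obtain C where C: "0 \<le> C" "\<And>f. f \<in> Lalpha \<alpha> \<Longrightarrow> cmod (\<phi> f) \<le> C * lnorm f"
    using bounded_functional_onE[OF \<phi>] by (metis enn2real_nonneg)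
  have diff_le: "cmod (\<psi> (H (k j)) - e j * \<phi> (H (k j))) \<le> (1/2) ^ j * (C * 2)" for j
  proof -
    have "\<psi> (H (k j)) - e j * \<phi> (H (k j)) = \<phi> (\<lambda>z. (w z - e j) * H (k j) z)"
      using dual_diff[OF \<phi> Lalpha_mult[OF H wL] Lalpha_cmult[OF H], of "k j" "e j" "k j"] dual_cmult[OF \<phi> H]
      by (simp add: \<psi>_def left_diff_distrib)
    also have "cmod \<dots> \<le> C * lnorm (\<lambda>z. (w z - e j) * H (k j) z)"
      by (rule C(2)[OF Lalpha_mult[OF H Linfty_diff[OF wL Linfty_const]]])
    also have "\<dots> \<le> C * (2 * (1/2) ^ j)" by (rule mult_left_mono[OF wH C(1)])
    finally show ?thesis by (simp add: mult_ac)
  qed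
  have "(\<lambda>j. (1/2) ^ j * (C * 2)) \<longlonglongrightarrow> 0"
    by (intro tendsto_mult_left_zero LIMSEQ_realpow_zero) auto
  then have diff0: "(\<lambda>j. \<psi> (H (k j)) - e j * \<phi> (H (k j))) \<longlonglongrightarrow> 0"
    by (rule Lim_null_comparison[rotated]) (use diff_le in simp)
  obtain c where c: "(\<lambda>n. \<phi> (H n)) \<longlonglongrightarrow> c" using conv[OF \<phi>] by (auto simp: convergent_def)
  obtain c' where c': "(\<lambda>n. \<psi> (H n)) \<longlonglongrightarrow> c'" using conv[OF \<psi>] by (auto simp: convergent_def)
  have sub: "strict_mono (\<lambda>i. k (2 * i))" "strict_mono (\<lambda>i. k (2 * i + 1))"
    using k_mono by (auto simp: strict_mono_def)
  \<comment> \<open>Even \<open>j\<close> show that \<open>\<psi>\<close> and \<open>\<phi>\<close>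
    have the same limit along \<open>H\<close>, odd \<open>j\<close> that the limit of
    \<open>\<psi>\<close> is 0.\<close>
  have "(\<lambda>i. \<psi> (H (k (2 * i))) - e (2 * i) * \<phi> (H (k (2 * i)))) \<longlonglongrightarrow> c' - c"
    using tendsto_diff[OF LIMSEQ_subseq_LIMSEQ[OF c' sub(1)] LIMSEQ_subseq_LIMSEQ[OF c sub(1)]]
    by (simp add: e_def o_def)
  moreover have "(\<lambda>i. \<psi> (H (k (2 * i))) - e (2 * i) * \<phi> (H (k (2 * i)))) \<longlonglongrightarrow> 0"
    using LIMSEQ_subseq_LIMSEQ[OF diff0, of "\<lambda>i. 2 * i"] by (simp add: strict_mono_def o_def)
  ultimately have "c' = c" using LIMSEQ_unique by fastforce
  have "(\<lambda>i. \<psi> (H (k (2 * i + 1))) - e (2 * i + 1) * \<phi> (H (k (2 * i + 1)))) \<longlonglongrightarrow> c'"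
    using LIMSEQ_subseq_LIMSEQ[OF c' sub(2)] by (simp add: e_def o_def)
  moreover have "(\<lambda>i. \<psi> (H (k (2 * i + 1))) - e (2 * i + 1) * \<phi> (H (k (2 * i + 1)))) \<longlonglongrightarrow> 0"
    using LIMSEQ_subseq_LIMSEQ[OF diff0, of "\<lambda>i. 2 * i + 1"] by (simp add: strict_mono_def o_def)
  ultimately have "c' = 0" using LIMSEQ_unique by blast
  then show ?thesis using c \<open>c' = c\<close> by simp
qed

lemma weakly_sequentially_complete_if:
  assumes eq: "Lalpha \<alpha> = calL \<alpha>"
  shows "weakly_sequentially_complete_on (Lalpha \<alpha>) lnorm"
  unfolding weakly_sequentially_complete_on_def
proof (intro allI impI)
  fix F assume F: "\<forall>n. F n \<in> Lalpha \<alpha>" and wC: "weakly_Cauchy_on (Lalpha \<alpha>) lnorm F"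
  then obtain K where K: "\<And>n. lnorm (F n) \<le> K"
    using weakly_Cauchy_imp_bounded by blast
  have K0: "0 \<le> K" using K[of 0] enn2real_nonneg order_trans by blast
  have FK: "ext_norm \<alpha> (F n) \<le> ennreal K" for n
    using K[of n] ext_norm_finite[OF F[rule_format, of n]] by (metis ennreal_enn2real ennreal_leI)
  have Fint: "integrable circle_measure (F n)" for n
    using F eq by (auto intro: calL_integrable)
  have FK1: "(\<integral>z. cmod (F n z) \<partial>circle_measure) \<le> K" for n
    using integral_cmod_le_ext_norm[of "F n"] K[of n] F eq by (metis order_trans)
  obtain h f where h: "\<And>k. h k \<in> midhull F k" and f: "f \<in> borel_measurable circle_measure"
    and lim: "AE z in circle_measure. (\<lambda>k. h k z) \<longlonglongrightarrow> f z"
  proof (rule circle.midhull_AE_convergent[of F K, OF Fint FK1])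
    fix h f assume "\<And>k. h k \<in> midhull F k" "f \<in> borel_measurable circle_measure"
      "AE z in circle_measure. (\<lambda>k. h k z) \<longlonglongrightarrow> f z"
    then show thesis by (rule that)
  qed
  have mh: "g \<in> Lalpha \<alpha> \<and> ext_norm \<alpha> g \<le> ennreal K" if "g \<in> midhull F N" for g N
    using that
  proof induction
    case (base n)
    then show ?case using F FK by simp
  next
    case (mid g g')
    have "ext_norm \<alpha> (\<lambda>z. (g z + g' z) / 2) = ennreal (1/2) * ext_norm \<alpha> (\<lambda>z. g z + g' z)"
      using ext_norm_cmult[of "1/2" "\<lambda>z. g z + g' z"] by (simp add: norm_divide)
    also have "\<dots> \<le> ennreal (1/2) * (ext_norm \<alpha> g + ext_norm \<alpha> g')"
      using mid by (intro mult_left_mono ext_norm_add Lalpha_measurable) auto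
    also have "\<dots> \<le> ennreal (1/2) * (ennreal K + ennreal K)"
      using mid by (intro mult_left_mono add_mono) auto
    also have "\<dots> = ennreal (1/2) * ennreal (K + K)"
      by (simp only: ennreal_plus[OF K0 K0])
    also have "\<dots> = ennreal (1/2 * (K + K))"
      using K0 by (intro ennreal_mult[symmetric]) auto
    also have "\<dots> = ennreal K" by simp
    finally show ?case
      using mid Lalpha_cmult[OF Lalpha_add, of g g' "1/2"] by simp
  qed
  have hL: "h k \<in> Lalpha \<alpha>" for k using mh[OF h] by simp
  have "ext_norm \<alpha> f \<le> ennreal K"
    using mh[OF h] by (intro ext_norm_le_of_lim[OF Lalpha_measurable[OF hL] lim]) simp
  \<comment> \<open>The bound from Fatou's lemma only puts \<open>f\<close> in
    \<open>calL \<alpha>\<close>; the assumed equality moves it into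
    \<open>Lalpha \<alpha>\<close>.\<close>
  then have fL: "f \<in> Lalpha \<alpha>"
    unfolding eq using f by (auto simp: calL_def intro: le_less_trans)
  have h_lim: "(\<lambda>k. \<phi> (h k)) \<longlonglongrightarrow> lim (\<lambda>n. \<phi> (F n))" and F_lim: "(\<lambda>n. \<phi> (F n)) \<longlonglongrightarrow> lim (\<lambda>n. \<phi> (F n))"
    if \<phi>: "dual \<phi>" for \<phi>
  proof -
    have "Cauchy (\<lambda>n. \<phi> (F n))" using wC \<phi> by (simp add: weakly_Cauchy_on_def)
    then show lim: "(\<lambda>n. \<phi> (F n)) \<longlonglongrightarrow> lim (\<lambda>n. \<phi> (F n))"
      by (simp add: Cauchy_convergent_iff convergent_LIMSEQ_iff)
    define l where "l = lim (\<lambda>n. \<phi> (F n))"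
    show "(\<lambda>k. \<phi> (h k)) \<longlonglongrightarrow> lim (\<lambda>n. \<phi> (F n))"
    proof (rule LIMSEQ_I)
      fix r :: real assume "0 < r"
      then obtain N where N: "\<And>n. N \<le> n \<Longrightarrow> cmod (\<phi> (F n) - l) < r"
        using LIMSEQ_D[OF lim] unfolding l_def by blast
      \<comment> \<open>A disc around \<open>l\<close> is convex, so a bound valid on a tail of
        \<open>F\<close> holds on its midpoint hull.\<close>
      have "cmod (\<phi> g - l) < r" if "g \<in> midhull F N" for g
        using that
      proof induction
        case (mid g g')
        have gL: "g \<in> Lalpha \<alpha>" "g' \<in> Lalpha \<alpha>" using mid mh by auto
        have "\<phi> (\<lambda>z. (g z + g' z) / 2) = \<phi> (\<lambda>z. (1/2) * (g z + g' z))" by simp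
        also have "\<dots> = (1/2) * (\<phi> g + \<phi> g')"
          unfolding dual_cmult[OF \<phi> Lalpha_add[OF gL]] dual_add[OF \<phi> gL] ..
        finally have eq: "\<phi> (\<lambda>z. (g z + g' z) / 2) - l = ((\<phi> g - l) + (\<phi> g' - l)) / 2"
          by (simp add: field_simps)
        have "cmod (\<phi> (\<lambda>z. (g z + g' z) / 2) - l) = cmod ((\<phi> g - l) + (\<phi> g' - l)) / 2"
          by (simp only: eq norm_divide norm_numeral)
        also have "\<dots> \<le> (cmod (\<phi> g - l) + cmod (\<phi> g' - l)) / 2"
          by (intro divide_right_mono norm_triangle_ineq) simp
        also have "\<dots> < r" using mid by simp
        finally show ?case .
      qed (rule N)
      then show "\<exists>no. \<forall>n\<ge>no. norm (\<phi> (h n) - lim (\<lambda>n. \<phi> (F n))) < r"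
        using midhull_antimono[OF h] unfolding l_def by blast
    qed
  qed
  show "weakly_convergent_on (Lalpha \<alpha>) lnorm F"
    unfolding weakly_convergent_on_def
  proof (intro bexI[OF _ fL] allI impI)
    fix \<phi> assume \<phi>: "dual \<phi>"
    have "(\<lambda>k. \<phi> (\<lambda>z. h k z - f z)) \<longlonglongrightarrow> 0"
    proof (rule weakly_convergent_AE_null_imp_null[OF Lalpha_diff[OF hL fL] _ _ \<phi>])
      show "AE z in circle_measure. (\<lambda>k. h k z - f z) \<longlonglongrightarrow> 0"
        using lim by eventually_elim (simp add: LIM_zero_iff)
      show "convergent (\<lambda>k. \<phi>' (\<lambda>z. h k z - f z))" if \<phi>': "dual \<phi>'" for \<phi>'
        using tendsto_diff[OF h_lim[OF \<phi>'] tendsto_const[of "\<phi>' f"]] dual_diff[OF \<phi>' hL fL]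
        by (auto simp: convergent_def)
    qed
    moreover have "(\<lambda>k. \<phi> (\<lambda>z. h k z - f z)) \<longlonglongrightarrow> lim (\<lambda>n. \<phi> (F n)) - \<phi> f"
      using tendsto_diff[OF h_lim[OF \<phi>] tendsto_const[of "\<phi> f"]] dual_diff[OF \<phi> hL fL] by simp
    ultimately have "lim (\<lambda>n. \<phi> (F n)) = \<phi> f" using LIMSEQ_unique by fastforce
    then show "(\<lambda>n. \<phi> (F n)) \<longlonglongrightarrow> \<phi> f" using F_lim[OF \<phi>] by simp
  qed
qed

text \<open>
  The truncations of \<open>f\<close> are weakly Cauchy because their increments have disjoint supports:
  \<open>\<Sum>k<N. \<bar>\<phi> (d k)\<bar>\<close> is the value of \<open>\<phi>\<close> at a unimodular combination of the \<open>d k\<close>.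
\<close>

lemma Lalpha_eq_calL_if:
  assumes wsc: "weakly_sequentially_complete_on (Lalpha \<alpha>) lnorm"
  shows "Lalpha \<alpha> = calL \<alpha>"
proof (intro antisym Lalpha_subset_calL subsetI)
  fix f assume f: "f \<in> calL \<alpha>"
  have fm [measurable]: "f \<in> borel_measurable circle_measure" by (rule calL_measurable[OF f])
  \<comment> \<open>Values above height \<open>n\<close> are replaced by 0 instead of being capped
    in modulus; this gives the increments disjoint supports, so that their moduli telescope in
    \<open>d_cmod\<close>.\<close>
  define F where "F n z = (if cmod (f z) \<le> real n then f z else 0)" for n z
  have FLi: "F n \<in> Linfty" for n
  proof (rule LinftyI)
    show "F n \<in> borel_measurable circle_measure" unfolding F_def[abs_def] by measurable
    show "AE z in circle_measure. cmod (F n z) \<le> real n" by (simp add: F_def)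
  qed
  have FL: "F n \<in> Lalpha \<alpha>" for n using FLi Linfty_subset_Lalpha by auto
  have F_lim: "(\<lambda>n. F n z) \<longlonglongrightarrow> f z" for z
  proof -
    obtain m where m: "cmod (f z) \<le> real m" using real_arch_simple by blast
    have "eventually (\<lambda>n. F n z = f z) sequentially"
      using eventually_ge_at_top[of m] by eventually_elim (use m in \<open>auto simp: F_def\<close>)
    then show ?thesis by (rule tendsto_eventually)
  qed
  have F_le: "cmod (F n z) \<le> cmod (f z)" for n z by (simp add: F_def)
  define d where "d n z = F (Suc n) z - F n z" for n z
  have dL: "d n \<in> Linfty" for n unfolding d_def by (rule Linfty_diff[OF FLi FLi])
  have d_cmod: "cmod (d n z) = cmod (F (Suc n) z) - cmod (F n z)" for n z
    by (simp add: d_def F_def)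
  have conv: "convergent (\<lambda>n. \<phi> (F n))" if \<phi>: "dual \<phi>" for \<phi>
  proof -
    obtain C where C: "0 \<le> C" "\<And>f. f \<in> Lalpha \<alpha> \<Longrightarrow> cmod (\<phi> f) \<le> C * lnorm f"
      using bounded_functional_onE[OF \<phi>] by (metis enn2real_nonneg)
    have bound: "(\<Sum>k<N. cmod (\<phi> (d k))) \<le> C * lnorm f" for N
    proof -
      \<comment> \<open>The factor \<open>c k\<close> turns the value of \<open>\<phi>\<close> at
        \<open>d k\<close> into its modulus.\<close>
      define c where "c k = cnj (sgn (\<phi> (d k)))" for k
      have c: "c k * \<phi> (d k) = of_real (cmod (\<phi> (d k)))" for k
      proof (cases "\<phi> (d k) = 0")
        case False
        have "cnj (\<phi> (d k)) * \<phi> (d k) = (of_real (cmod (\<phi> (d k))))\<^sup>2"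
          using complex_norm_square[of "\<phi> (d k)"] by (simp add: mult.commute)
        then show ?thesis
          using False by (simp add: c_def sgn_eq power2_eq_square)
      qed simp
      let ?g = "\<lambda>z. \<Sum>k<N. c k * d k z"
      have gL: "?g \<in> Lalpha \<alpha>"
        by (intro subsetD[OF Linfty_subset_Lalpha] Linfty_sum Linfty_cmult dL)
      have "of_real (\<Sum>k<N. cmod (\<phi> (d k))) = \<phi> ?g"
        using dual_sum[OF \<phi>, of "{..<N}" d c, OF dL] c by simp
      then have "cmod (\<phi> ?g) = \<bar>\<Sum>k<N. cmod (\<phi> (d k))\<bar>"
        by (metis norm_of_real)
      then have "(\<Sum>k<N. cmod (\<phi> (d k))) = cmod (\<phi> ?g)"
        by (simp add: sum_nonneg)
      also have "\<dots> \<le> C * lnorm ?g" by (rule C(2)[OF gL])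
      also have "\<dots> \<le> C * lnorm f"
      proof (intro mult_left_mono C(1) enn2real_mono ext_norm_mono AE_I2)
        fix z
        have "cmod (?g z) \<le> (\<Sum>k<N. cmod (d k z))"
          by (rule order_trans[OF norm_sum sum_mono])
             (auto simp: norm_mult c_def norm_sgn mult_left_le_one_le)
        also have "\<dots> = cmod (F N z) - cmod (F 0 z)"
          unfolding d_cmod by (rule sum_lessThan_telescope)
        also have "\<dots> \<le> cmod (f z)" using F_le[of N z] norm_ge_zero[of "F 0 z"] by linarith
        finally show "cmod (?g z) \<le> cmod (f z)" .
      qed (use f in \<open>simp add: calL_def\<close>)
      finally show ?thesis .
    qed
    have "summable (\<lambda>k. cmod (\<phi> (d k)))"
    proof (rule bounded_imp_summable)
      show "(\<Sum>k\<le>n. cmod (\<phi> (d k))) \<le> C * lnorm f" for n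
        using bound[of "Suc n"] by (simp only: lessThan_Suc_atMost)
    qed simp
    then have "summable (\<lambda>k. \<phi> (d k))" by (rule summable_norm_cancel)
    then have "summable (\<lambda>k. \<phi> (F (Suc k)) - \<phi> (F k))"
      unfolding d_def dual_diff[OF \<phi> FL FL] .
    then have "convergent (\<lambda>n. \<Sum>k<n. \<phi> (F (Suc k)) - \<phi> (F k))"
      by (simp add: summable_iff_convergent)
    then have "convergent (\<lambda>n. \<phi> (F 0) + (\<phi> (F n) - \<phi> (F 0)))"
      unfolding sum_lessThan_telescope[of "\<lambda>k. \<phi> (F k)"] by (intro convergent_add convergent_const)
    then show ?thesis by simp
  qed
  then have "weakly_Cauchy_on (Lalpha \<alpha>) lnorm F"
    by (simp add: weakly_Cauchy_on_def Cauchy_convergent_iff)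
  then obtain g where g: "g \<in> Lalpha \<alpha>" and gl: "\<And>\<phi>. dual \<phi> \<Longrightarrow> (\<lambda>n. \<phi> (F n)) \<longlonglongrightarrow> \<phi> g"
    using wsc FL unfolding weakly_sequentially_complete_on_def weakly_convergent_on_def by blast
  have gc: "g \<in> calL \<alpha>" using g Lalpha_subset_calL by auto
  have gm [measurable]: "g \<in> borel_measurable circle_measure" by (rule calL_measurable[OF gc])
  have fi: "integrable circle_measure f" and gi: "integrable circle_measure g"
    using calL_integrable f gc by auto
  \<comment> \<open>With this \<open>u\<close> the product \<open>u * (g - f)\<close> is
    \<open>|g - f|\<close>, so one functional tests the whole \<open>L^1\<close>-distance of the
    weak limit from \<open>f\<close>.\<close>
  define u where "u z = cnj (sgn (g z - f z))" for z
  have [measurable]: "u \<in> borel_measurable circle_measure"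
    unfolding u_def sgn_div_norm
    by (rule measurable_compose[OF _ borel_measurable_continuous_onI[of cnj]])
       (auto intro: continuous_intros)
  have u1: "cmod (u z) \<le> 1" for z by (simp add: u_def norm_sgn)
  have uL: "u \<in> Linfty" by (rule LinftyI[of _ 1]) (use u1 in auto)
  have ui: "integrable circle_measure (\<lambda>z. u z * h z)" if "integrable circle_measure h" for h
    by (rule Bochner_Integration.integrable_bound[OF that])
       (use that u1 in \<open>auto simp: norm_mult mult_left_le_one_le\<close>)
  have "(\<lambda>n. \<integral>z. u z * F n z \<partial>circle_measure) \<longlonglongrightarrow> (\<integral>z. u z * f z \<partial>circle_measure)"
  proof (rule integral_dominated_convergence[where w = "\<lambda>z. cmod (f z)"])
    show "AE z in circle_measure. cmod (u z * F n z) \<le> cmod (f z)" for n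
    proof (rule AE_I2)
      fix z
      have "cmod (u z * F n z) \<le> 1 * cmod (F n z)"
        unfolding norm_mult by (intro mult_right_mono u1) simp
      then show "cmod (u z * F n z) \<le> cmod (f z)" using F_le[of n z] by simp
    qed
    show "AE z in circle_measure. (\<lambda>n. u z * F n z) \<longlonglongrightarrow> u z * f z"
      by (intro AE_I2 tendsto_mult tendsto_const F_lim)
  qed (use fi Linfty_measurable[OF FLi] in auto)
  moreover have "(\<lambda>n. \<integral>z. u z * F n z \<partial>circle_measure) \<longlonglongrightarrow> (\<integral>z. u z * g z \<partial>circle_measure)"
    by (rule gl[OF dual_integral[OF uL u1]])
  ultimately have "(\<integral>z. u z * g z \<partial>circle_measure) = (\<integral>z. u z * f z \<partial>circle_measure)"
    using LIMSEQ_unique by blast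
  then have "(\<integral>z. u z * (g z - f z) \<partial>circle_measure) = 0"
    using ui[OF fi] ui[OF gi] by (simp add: right_diff_distrib)
  also have "(\<lambda>z. u z * (g z - f z)) = (\<lambda>z. of_real (cmod (g z - f z)))"
  proof
    fix z
    have "cnj (g z - f z) * (g z - f z) = (of_real (cmod (g z - f z)))\<^sup>2"
      using complex_norm_square[of "g z - f z"] by (simp add: mult.commute)
    then show "u z * (g z - f z) = of_real (cmod (g z - f z))"
      by (cases "g z = f z") (simp_all add: u_def sgn_eq power2_eq_square del: complex_cnj_diff)
  qed
  finally have "(\<integral>z. cmod (g z - f z) \<partial>circle_measure) = 0"
    by (simp add: integral_complex_of_real)
  then have "AE z in circle_measure. cmod (g z - f z) = 0"
    using fi gi by (subst (asm) integral_nonneg_eq_0_iff_AE) auto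
  then have "AE z in circle_measure. g z = f z" by simp
  then show "f \<in> Lalpha \<alpha>" by (rule Lalpha_cong[OF g fm])
qed

end

theorem theorem3p5:
  fixes \<alpha> :: "(complex \<Rightarrow> complex) \<Rightarrow> real"
  assumes "\<alpha> \<in> Rc"
  shows "Lalpha \<alpha> = calL \<alpha> \<longleftrightarrow>
    weakly_sequentially_complete_on (Lalpha \<alpha>) (\<lambda>f. enn2real (ext_norm \<alpha> f))"
proof -
  interpret Rc_norm \<alpha> by unfold_locales (rule assms)
  show ?thesis
    using weakly_sequentially_complete_if Lalpha_eq_calL_if by blast
qed

end
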